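(* Let $G$ be a graph having zero as an eigenvalue (of its adjacency matrix). Suppose that $G$ has perfect state transfer at time $\pi/2$ between vertices $u$ and $v$. Then there is pretty good state transfer between $(u,0)$ and $(v,0)$ in the corona $G\circ K_1$.
   Context: Graphs are finite, simple and undirected; $A(X)$ is the adjacency matrix of a graph $X$ and $e_a$ the standard basis vector indexed by vertex $a$. There is perfect state transfer between distinct vertices $u,v$ of $X$ at time $\tau$ if $|e_v^Te^{-\mathrm{i}\tau A(X)}e_u|=1$. $K_1$ is the one-vertex graph. The corona $G\circ H$ of graphs $G,H$ has vertex set $V(G)\times(\{0\}\cup V(H))$ (where $0\notin V(H)$), and $(v,w)$ is adjacent to $(v',w')$ iff one of the following holds: $w=w'=0$ and $v,v'$ are adjacent in $G$; or $v=v'$ and $w,w'\in V(H)$ are adjacent in $H$; or $v=v'$ and exactly one of $w,w'$ equals $0$. A graph $X$ has pretty good state transfer between vertices $a,b$ if for every $\epsilon>0$ there are a time $\tau$ and a complex number $\gamma$ with $|\gamma|=1$ such that $\|e^{-\mathrm{i}\tau A(X)}e_a-\gamma e_b\|<\epsilon$. *)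

theory Defs
  imports "HOL-Analysis.Analysis"
begin

text \<open>
  A graph is given by its adjacency relation; its vertex set is the whole (finite) type.
\<close>

definition simple_graph :: "('a::finite \<Rightarrow> 'a \<Rightarrow> bool) \<Rightarrow> bool" where
  "simple_graph G \<longleftrightarrow> symp G \<and> irreflp G"

definition adj_matrix :: "('a::finite \<Rightarrow> 'a \<Rightarrow> bool) \<Rightarrow> complex^'a^'a" where
  "adj_matrix G = (\<chi> a b. if G a b then 1 else 0)"

definition eigenvalue :: "complex^'a^'a \<Rightarrow> complex \<Rightarrow> bool" where
  "eigenvalue M c \<longleftrightarrow> (\<exists>x. x \<noteq> 0 \<and> M *v x = c *s x)"

text \<open>
  The operations \<open>*\<close> and \<open>1\<close> of the type \<open>complex^'a^'a\<close> are componentwise, so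
  the generic power and \<open>exp\<close> are not the ones of the matrix algebra.
\<close>

primrec matrix_power :: "complex^'a^'a \<Rightarrow> nat \<Rightarrow> complex^'a^'a" where
  "matrix_power M 0 = mat 1"
| "matrix_power M (Suc k) = M ** matrix_power M k"

definition matrix_exp :: "complex^'a^'a \<Rightarrow> complex^'a^'a" where
  "matrix_exp M = (\<Sum>k. matrix_power M k /\<^sub>R fact k)"

text \<open>\<open>e\<^bsup>-i\<tau>A(X)\<^esup>\<close>\<close>

definition transition_matrix :: "('a::finite \<Rightarrow> 'a \<Rightarrow> bool) \<Rightarrow> real \<Rightarrow> complex^'a^'a" where
  "transition_matrix X \<tau> = matrix_exp (map_matrix (\<lambda>z. - \<i> * of_real \<tau> * z) (adj_matrix X))"

text \<open>The component at \<open>v\<close> below is the product with the row vector \<open>e\<^sub>v\<^sup>T\<close>.\<close>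

definition perfect_state_transfer ::
  "('a::finite \<Rightarrow> 'a \<Rightarrow> bool) \<Rightarrow> real \<Rightarrow> 'a \<Rightarrow> 'a \<Rightarrow> bool" where
  "perfect_state_transfer X \<tau> u v \<longleftrightarrow>
     u \<noteq> v \<and> norm ((transition_matrix X \<tau> *v axis u 1) $ v) = 1"

text \<open>The norm on \<open>complex^'a\<close> is the Euclidean one.\<close>

definition pretty_good_state_transfer ::
  "('a::finite \<Rightarrow> 'a \<Rightarrow> bool) \<Rightarrow> 'a \<Rightarrow> 'a \<Rightarrow> bool" where
  "pretty_good_state_transfer X a b \<longleftrightarrow>
     (\<forall>\<epsilon>>0. \<exists>(\<tau>::real) (\<gamma>::complex). norm \<gamma> = 1 \<and>
        norm (transition_matrix X \<tau> *v axis a 1 - \<gamma> *s axis b 1) < \<epsilon>)"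

definition K1 :: "unit \<Rightarrow> unit \<Rightarrow> bool" where
  "K1 x y \<longleftrightarrow> False"

text \<open>\<open>None\<close> plays the role of the extra symbol \<open>0\<close> not in the vertex set of \<open>H\<close>.\<close>

definition corona :: "('a::finite \<Rightarrow> 'a \<Rightarrow> bool) \<Rightarrow> ('b::finite \<Rightarrow> 'b \<Rightarrow> bool) \<Rightarrow>
    'a \<times> 'b option \<Rightarrow> 'a \<times> 'b option \<Rightarrow> bool" where
  "corona G H = (\<lambda>(v, w) (v', w').
      (w = None \<and> w' = None \<and> G v v') \<or>
      (v = v' \<and> (\<exists>x y. w = Some x \<and> w' = Some y \<and> H x y)) \<or>
      (v = v' \<and> (w = None) \<noteq> (w' = None)))"

lemma simple_graph_K1: "simple_graph K1"
  by (auto simp: simple_graph_def K1_def symp_def irreflp_def)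

lemma simple_graph_corona:
  assumes "simple_graph G" "simple_graph H"
  shows "simple_graph (corona G H)"
  using assms unfolding simple_graph_def symp_def irreflp_def corona_def by fastforce

text \<open>The exponential series converges for every matrix, so that \<open>suminf\<close> is its sum.\<close>

lemma norm_matrix_power_entry_le:
  "norm (matrix_power M k $ i $ j) \<le> (\<Sum>i\<in>UNIV. \<Sum>j\<in>UNIV. norm (M $ i $ j)) ^ k"
proof (induction k arbitrary: i j)
  case 0
  then show ?case by (simp add: mat_def)
next
  case (Suc k)
  let ?B = "\<Sum>i\<in>UNIV. \<Sum>j\<in>UNIV. norm (M $ i $ j)"
  have B0: "?B \<ge> 0" by (intro sum_nonneg) auto
  have row: "(\<Sum>l\<in>UNIV. norm (M $ i $ l)) \<le> ?B"
    by (rule member_le_sum[of i UNIV "\<lambda>i. \<Sum>l\<in>UNIV. norm (M $ i $ l)"])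
      (auto intro: sum_nonneg)
  have "norm (matrix_power M (Suc k) $ i $ j)
      \<le> (\<Sum>l\<in>UNIV. norm (M $ i $ l) * norm (matrix_power M k $ l $ j))"
    by (simp add: matrix_matrix_mult_def sum_norm_le norm_mult)
  also have "\<dots> \<le> (\<Sum>l\<in>UNIV. norm (M $ i $ l) * ?B ^ k)"
    by (intro sum_mono mult_left_mono Suc) auto
  also have "\<dots> = (\<Sum>l\<in>UNIV. norm (M $ i $ l)) * ?B ^ k"
    by (simp add: sum_distrib_right)
  also have "\<dots> \<le> ?B * ?B ^ k"
    using B0 row by (intro mult_right_mono) auto
  finally show ?case by simp
qed

lemma summable_matrix_exp: "summable (\<lambda>k. matrix_power M k /\<^sub>R fact k)"
  for M :: "complex^'a^'a"
proof -
  let ?B = "\<Sum>i\<in>UNIV. \<Sum>j\<in>UNIV. norm (M $ i $ j)"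
  let ?n = "real CARD('a)"
  have "norm (matrix_power M k /\<^sub>R fact k) \<le> ?n * ?n * (?B ^ k /\<^sub>R fact k)" for k
  proof -
    have "norm (matrix_power M k) \<le> (\<Sum>i\<in>UNIV. norm (matrix_power M k $ i))"
      unfolding norm_vec_def[of "matrix_power M k"] by (rule L2_set_le_sum) auto
    also have "\<dots> \<le> (\<Sum>i\<in>(UNIV::'a set). \<Sum>j\<in>UNIV. norm (matrix_power M k $ i $ j))"
      by (intro sum_mono, subst norm_vec_def) (rule L2_set_le_sum, auto)
    also have "\<dots> \<le> (\<Sum>i\<in>(UNIV::'a set). \<Sum>j\<in>(UNIV::'a set). ?B ^ k)"
      by (intro sum_mono norm_matrix_power_entry_le)
    finally have "norm (matrix_power M k) \<le> ?n * ?n * ?B ^ k" by simp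
    then show ?thesis by (simp add: field_simps)
  qed
  moreover have "summable (\<lambda>k. ?n * ?n * (?B ^ k /\<^sub>R fact k))"
    by (intro summable_mult summable_exp_generic)
  ultimately show ?thesis
    by (rule summable_comparison_test'[where N = 0, rotated])
qed

end

theory Submission
  imports Defs "HOL-Computational_Algebra.Squarefree"
begin

text \<open>
  Write \<open>e\<^sub>u = \<Sum>\<^sub>l y\<^sub>l\<close> with \<open>y\<^sub>l\<close> a nonzero real eigenvector of \<open>A(G)\<close> for the eigenvalue \<open>l\<close>,
  \<open>l\<close> ranging over a finite set \<open>S\<close> (\<open>symmetric_matrix_eigen_decomposition\<close>). Perfect state
  transfer at time \<open>\<pi>/2\<close> says that \<open>e\<^bsup>-i\<pi>l/2\<^esup> = \<gamma> \<sigma>\<^sub>l\<close> with a common phase \<open>\<gamma>\<close> and signs \<open>\<sigma>\<^sub>l\<close>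
  for which \<open>e\<^sub>v = \<Sum>\<^sub>l \<sigma>\<^sub>l y\<^sub>l\<close> (\<open>perfect_state_transfer_spectral\<close>). Squaring shows that any two
  elements of \<open>S\<close> differ by an even integer, and since the entries of all \<open>A\<^sup>k e\<^sub>u\<close> are integers,
  this forces the elements of \<open>S\<close> to be integers themselves (\<open>spectrum_integral\<close>), all of the
  same parity.

  An eigenvector \<open>y\<close> of \<open>G\<close> for \<open>l\<close> gives two eigenvectors \<open>(\<theta> y, y)\<close> of \<open>G \<circ> K\<^sub>1\<close>, where
  \<open>\<theta> = (l \<plusminus> \<surd>(l\<^sup>2 + 4)) / 2\<close>, and \<open>(y, 0)\<close> is a combination of these two. At a time
  \<open>\<tau> = (4j + 1)\<pi>\<close> with \<open>j\<close> an integer the factor \<open>e\<^bsup>-i\<tau>l/2\<^esup>\<close> is again \<open>\<gamma> \<sigma>\<^sub>l\<close>. Hence the theorem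
  follows once \<open>j\<close> can be chosen so that all the numbers \<open>e\<^bsup>\<plusminus>i\<tau>\<surd>(l\<^sup>2 + 4)/2\<^esup>\<close> are close to one and
  the same sign \<open>\<omega>\<close> (\<open>corona_phases_simultaneous\<close>). Write \<open>\<surd>(l\<^sup>2 + 4) / 2 = c s \<surd>d\<close> with \<open>d\<close>
  squarefree. If the eigenvalues are even, take \<open>c = 1\<close>; then \<open>s\<^sup>2 d = (l/2)\<^sup>2 + 1\<close> is not
  divisible by 4, so \<open>s\<close> is odd, and it suffices that every \<open>(4j + 1)\<surd>d\<close> is close to \<open>1\<close> modulo \<open>4\<close>
  (\<open>\<omega> = -1\<close>). If they are odd, take \<open>c = 1/2\<close>; then \<open>s\<^sup>2 d = l\<^sup>2 + 4\<close> is 5 modulo 8 and not a square, so \<open>d \<noteq> 1\<close>,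
  and it suffices that every \<open>(4j + 1)\<surd>d\<close> is close to \<open>0\<close> modulo \<open>4\<close> (\<open>\<omega> = 1\<close>). Both are instances of
  Kronecker's approximation theorem, because the square roots of distinct squarefree numbers
  are linearly independent over the rationals (\<open>sqrt_squarefree_independent\<close>).
\<close>

section \<open>Square roots of squarefree numbers\<close>

text \<open>
  A set of reals that is a subfield; as \<open>inverse 0 = 0\<close>, zero needs no exception.
\<close>

definition real_subfield :: "real set \<Rightarrow> bool" where
  "real_subfield F \<longleftrightarrow> \<rat> \<subseteq> F \<and> (\<forall>x\<in>F. \<forall>y\<in>F. x + y \<in> F \<and> x * y \<in> F) \<and> (\<forall>x\<in>F. inverse x \<in> F)"

lemma real_subfield_closed:
  assumes "real_subfield F"
  shows real_subfield_Rats: "x \<in> \<rat> \<Longrightarrow> x \<in> F"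
    and real_subfield_add: "x \<in> F \<Longrightarrow> y \<in> F \<Longrightarrow> x + y \<in> F"
    and real_subfield_mult: "x \<in> F \<Longrightarrow> y \<in> F \<Longrightarrow> x * y \<in> F"
    and real_subfield_inverse: "x \<in> F \<Longrightarrow> inverse x \<in> F"
    and real_subfield_minus: "x \<in> F \<Longrightarrow> - x \<in> F"
    and real_subfield_diff: "x \<in> F \<Longrightarrow> y \<in> F \<Longrightarrow> x - y \<in> F"
    and real_subfield_divide: "x \<in> F \<Longrightarrow> y \<in> F \<Longrightarrow> x / y \<in> F"
proof -
  show Rats: "x \<in> \<rat> \<Longrightarrow> x \<in> F" for x using assms unfolding real_subfield_def by blast
  show add: "x \<in> F \<Longrightarrow> y \<in> F \<Longrightarrow> x + y \<in> F" for x y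
    using assms unfolding real_subfield_def by blast
  show mult: "x \<in> F \<Longrightarrow> y \<in> F \<Longrightarrow> x * y \<in> F" for x y
    using assms unfolding real_subfield_def by blast
  show inv: "x \<in> F \<Longrightarrow> inverse x \<in> F" for x
    using assms unfolding real_subfield_def by blast
  show minus: "x \<in> F \<Longrightarrow> - x \<in> F" for x
    using mult[of "-1" x] Rats[of "-1"] by simp
  show "x \<in> F \<Longrightarrow> y \<in> F \<Longrightarrow> x - y \<in> F"
    using add[of x "-y"] minus[of y] by simp
  show "x \<in> F \<Longrightarrow> y \<in> F \<Longrightarrow> x / y \<in> F"
    using mult[of x "inverse y"] inv[of y] by (simp add: divide_inverse)
qed

lemma real_subfield_sum:
  assumes "real_subfield F" "\<And>x. x \<in> A \<Longrightarrow> f x \<in> F"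
  shows "sum f A \<in> F"
  using assms(2)
proof (induction A rule: infinite_finite_induct)
  case (insert x A)
  then show ?case by (simp add: real_subfield_add[OF assms(1)])
qed (auto intro: real_subfield_Rats[OF assms(1)])

lemma real_subfield_adjoin_sqrt:
  assumes F: "real_subfield F"
  shows "real_subfield {a + b * sqrt (real p) | a b. a \<in> F \<and> b \<in> F}" (is "real_subfield ?K")
proof -
  note cl = real_subfield_closed[OF F]
  have p: "real p \<in> F" by (rule cl(1)) simp
  have FK: "x \<in> ?K" if "x \<in> F" for x
  proof -
    have "x = x + 0 * sqrt p" "0 \<in> F" using cl(1)[of 0] by auto
    with that show ?thesis by blast
  qed
  have inv: "inverse (a + b * sqrt p) \<in> ?K" if ab: "a \<in> F" "b \<in> F" for a b
  proof (cases "a + b * sqrt p = 0 \<or> b = 0 \<or> a - b * sqrt p = 0")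
    case True
    \<comment> \<open>If the conjugate vanishes, then \<open>b \<surd>p = a\<close> already lies in \<open>F\<close>.\<close>
    have "a + b * sqrt p \<in> F"
    proof (cases "b = 0")
      case False
      with True have "a + b * sqrt p = 0 \<or> a + b * sqrt p = a + a" by auto
      then show ?thesis using ab cl(1)[of 0] cl(2) by auto
    qed (use ab in auto)
    then show ?thesis by (intro FK cl(4))
  next
    case False
    have eq: "(a + b * sqrt p) * (a - b * sqrt p) = a * a - b * b * p"
      by (simp add: algebra_simps)
    have "(a + b * sqrt p) * (a - b * sqrt p) \<noteq> 0" using False by (metis mult_eq_0_iff)
    then have n0: "a * a - b * b * p \<noteq> 0" unfolding eq .
    \<comment> \<open>Rationalize the denominator by means of the conjugate.\<close>
    have "inverse (a + b * sqrt p) = (a - b * sqrt p) / (a * a - b * b * p)"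
      using eq n0 by (intro inverse_unique) simp
    also have "\<dots> = a / (a * a - b * b * p) + (- b / (a * a - b * b * p)) * sqrt p"
      by (simp add: diff_divide_distrib)
    finally have "inverse (a + b * sqrt p) = \<dots>" .
    moreover have "a / (a * a - b * b * p) \<in> F" "- b / (a * a - b * b * p) \<in> F"
      using ab p by (auto intro!: cl(2-))
    ultimately show ?thesis by blast
  qed
  have add: "(a + b * sqrt p) + (a' + b' * sqrt p) \<in> ?K"
    if "a \<in> F" "b \<in> F" "a' \<in> F" "b' \<in> F" for a b a' b'
  proof -
    have "(a + b * sqrt p) + (a' + b' * sqrt p) = (a + a') + (b + b') * sqrt p"
      by (simp add: algebra_simps)
    moreover have "a + a' \<in> F" "b + b' \<in> F" using that by (auto intro: cl(2))
    ultimately show ?thesis by blast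
  qed
  have mult: "(a + b * sqrt p) * (a' + b' * sqrt p) \<in> ?K"
    if "a \<in> F" "b \<in> F" "a' \<in> F" "b' \<in> F" for a b a' b'
  proof -
    have "(a + b * sqrt p) * (a' + b' * sqrt p)
        = (a * a' + b * b' * p) + (a * b' + a' * b) * sqrt p"
      by (simp add: algebra_simps)
    moreover have "a * a' + b * b' * p \<in> F" "a * b' + a' * b \<in> F"
      using that p by (auto intro!: cl(2,3))
    ultimately show ?thesis by blast
  qed
  show ?thesis unfolding real_subfield_def
  proof (intro conjI ballI subsetI)
    show "x \<in> ?K" if "x \<in> \<rat>" for x using FK[OF cl(1)[OF that]] .
  next
    fix x y assume "x \<in> ?K" "y \<in> ?K"
    then obtain a b a' b' where x: "x = a + b * sqrt p" and y: "y = a' + b' * sqrt p"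
      and F: "a \<in> F" "b \<in> F" "a' \<in> F" "b' \<in> F" by blast
    show "x + y \<in> ?K" unfolding x y using F by (rule add)
    show "x * y \<in> ?K" unfolding x y using F by (rule mult)
  next
    fix x assume "x \<in> ?K"
    then obtain a b where x: "x = a + b * sqrt p" and F: "a \<in> F" "b \<in> F" by blast
    show "inverse x \<in> ?K" unfolding x using F by (rule inv)
  qed
qed

text \<open>
  The field generated over the rationals by the square roots of the members of the list, built
  by adjoining one root after another.
\<close>

primrec sqrt_tower :: "nat list \<Rightarrow> real set" where
  "sqrt_tower [] = \<rat>"
| "sqrt_tower (p # ps) = {a + b * sqrt (real p) | a b. a \<in> sqrt_tower ps \<and> b \<in> sqrt_tower ps}"

lemma real_subfield_sqrt_tower: "real_subfield (sqrt_tower ps)"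
proof (induction ps)
  case Nil
  then show ?case by (auto simp: real_subfield_def)
next
  case (Cons p ps)
  then show ?case using real_subfield_adjoin_sqrt by simp
qed

lemma sqrt_tower_Cons_mono: "x \<in> sqrt_tower ps \<Longrightarrow> x \<in> sqrt_tower (p # ps)"
proof -
  assume "x \<in> sqrt_tower ps"
  moreover have "x = x + 0 * sqrt p" "0 \<in> sqrt_tower ps"
    using real_subfield_Rats[OF real_subfield_sqrt_tower, of 0 ps] by auto
  ultimately show ?thesis unfolding sqrt_tower.simps by blast
qed

lemma sqrt_squarefree_irrational:
  assumes "squarefree (d :: nat)" "sqrt (real d) \<in> \<rat>"
  shows "d = 1"
proof -
  obtain m n :: nat where n: "n \<noteq> 0" "\<bar>sqrt d\<bar> = m / n" "coprime m n"
    using Rats_abs_nat_div_natE[OF assms(2)] by metis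
  then have "sqrt d * n = m" by simp
  then have "(sqrt d * n)^2 = real m ^ 2" by simp
  then have "real (d * n^2) = real (m^2)" by (simp add: power_mult_distrib)
  then have eq: "d * n^2 = m^2" by (simp only: of_nat_eq_iff)
  then have "n^2 dvd m^2" by (metis dvd_triv_right)
  then have "n dvd m" by simp
  with n(3) have "n = 1" by (metis coprime_common_divisor_nat dvd_refl)
  with eq have "d = m^2" by simp
  with assms(1) show ?thesis by (simp add: squarefree_power_iff)
qed

text \<open>
  Squaring \<open>\<surd>d = a + b \<surd>p\<close> with \<open>a\<close>, \<open>b\<close> in the smaller field gives \<open>\<surd>p\<close>, \<open>\<surd>d\<close> or \<open>\<surd>(dp)\<close> as an element
  of that field, each of which the induction hypothesis excludes. Hence the generalization to
  all \<open>d\<close> prime to the list.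
\<close>

lemma sqrt_notin_sqrt_tower:
  assumes "distinct ps" "\<And>p. p \<in> set ps \<Longrightarrow> prime p"
    and "squarefree (d :: nat)" "d \<noteq> 1" "\<And>p. p \<in> set ps \<Longrightarrow> \<not> p dvd d"
  shows "sqrt (real d) \<notin> sqrt_tower ps"
  using assms
proof (induction ps arbitrary: d)
  case Nil
  then show ?case using sqrt_squarefree_irrational[of d] by auto
next
  case (Cons p ps)
  note cl = real_subfield_closed[OF real_subfield_sqrt_tower[of ps]]
  have prp: "prime p" using Cons.prems by simp
  have pp: "\<not> q dvd p" if "q \<in> set ps" for q
    using primes_dvd_imp_eq[of q p] prp Cons.prems(1,2) that by auto
  have IH: "sqrt (real e) \<notin> sqrt_tower ps"
    if "squarefree e" "e \<noteq> 1" "\<And>q. q \<in> set ps \<Longrightarrow> \<not> q dvd e" for e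
    using that Cons.prems by (intro Cons.IH) auto
  have nat_in: "real k \<in> sqrt_tower ps" for k by (rule cl(1)) simp
  show ?case
  proof
    assume "sqrt (real d) \<in> sqrt_tower (p # ps)"
    then obtain a b where ab: "a \<in> sqrt_tower ps" "b \<in> sqrt_tower ps"
      and eq: "sqrt d = a + b * sqrt p" by auto
    have "real d = (a + b * sqrt p)^2" unfolding eq[symmetric] by simp
    also have "\<dots> = a * a + b * b * p + 2 * (a * b) * sqrt p"
      by (simp add: power2_eq_square algebra_simps)
    finally have sq: "2 * (a * b) * sqrt p = d - (a * a + b * b * p)" by simp
    consider "a * b \<noteq> 0" | "b = 0" | "a = 0" by auto
    then show False
    proof cases
      case 1
      then have "sqrt p = (d - (a * a + b * b * p)) / (2 * (a * b))"
        using sq by (simp add: field_simps)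
      also have "\<dots> \<in> sqrt_tower ps"
        using ab nat_in nat_in[of 2] by (intro cl(2-)) auto
      finally show False using IH[of p] pp prp squarefree_prime[OF prp] not_prime_1 by metis
    next
      case 2
      then show False using IH[of d] ab eq Cons.prems by auto
    next
      case 3
      then have "sqrt (real (d * p)) = b * p" using eq by (simp add: real_sqrt_mult)
      moreover have "b * p \<in> sqrt_tower ps" using ab nat_in by (intro cl(2-))
      moreover have "squarefree (d * p)"
        using Cons.prems(3,5) prime_imp_coprime[OF prp, of d] squarefree_prime[OF prp]
        by (intro squarefree_mult_coprime) (auto simp: coprime_commute)
      moreover have "\<not> q dvd d * p" if "q \<in> set ps" for q
        using Cons.prems pp[OF that] that by (auto simp: prime_dvd_mult_iff)
      ultimately show False using IH[of "d * p"] prime_gt_1_nat[OF prp] by auto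
    qed
  qed
qed

lemma sqrt_in_sqrt_tower:
  assumes "squarefree (d :: nat)" "\<And>p. prime p \<Longrightarrow> p dvd d \<Longrightarrow> p \<in> set ps"
  shows "sqrt (real d) \<in> sqrt_tower ps"
  using assms
proof (induction ps arbitrary: d)
  case Nil
  then have "d = 1" by (metis emptyE list.set(1) prime_factor_nat)
  then show ?case by simp
next
  case (Cons p ps)
  show ?case
  proof (cases "prime p \<and> p dvd d")
    case True
    then obtain e where e: "d = p * e" by auto
    have "\<not> p dvd e"
    proof
      assume "p dvd e"
      then have "p^2 dvd d" unfolding e power2_eq_square by (intro mult_dvd_mono) auto
      with Cons.prems(1) True show False by (auto dest: squarefreeD)
    qed
    then have "q \<in> set ps" if "prime q" "q dvd e" for q
      using Cons.prems(2)[of q] that e by auto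
    then have "sqrt (real e) \<in> sqrt_tower ps"
      using Cons.prems(1) e by (intro Cons.IH) (auto dest: squarefree_multD)
    moreover have "sqrt d = 0 + sqrt e * sqrt p" "0 \<in> sqrt_tower ps"
      using real_subfield_Rats[OF real_subfield_sqrt_tower, of 0 ps] e
      by (auto simp: real_sqrt_mult)
    ultimately show ?thesis unfolding sqrt_tower.simps by blast
  next
    case False
    then have "sqrt d \<in> sqrt_tower ps"
      using Cons.prems by (intro Cons.IH) auto
    then show ?thesis by (rule sqrt_tower_Cons_mono)
  qed
qed

text \<open>
  A relation over the primes \<open>p # ps\<close> reads \<open>a + b \<surd>p = 0\<close>, where \<open>a\<close> collects the terms with \<open>p\<close> not
  dividing \<open>d\<close>. As \<open>\<surd>p\<close> is not in the field of \<open>ps\<close>, both \<open>a\<close> and \<open>b\<close> vanish, and these are shorter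
  relations over \<open>ps\<close>.
\<close>

lemma sqrt_squarefree_independent_tower:
  assumes "distinct ps" "\<And>p. p \<in> set ps \<Longrightarrow> prime p" "finite D"
    and "\<And>d. d \<in> D \<Longrightarrow> squarefree (d :: nat)"
    and "\<And>d p. d \<in> D \<Longrightarrow> prime p \<Longrightarrow> p dvd d \<Longrightarrow> p \<in> set ps"
    and "\<And>d. d \<in> D \<Longrightarrow> c d \<in> \<rat>"
    and "(\<Sum>d\<in>D. c d * sqrt (real d)) = 0"
    and "d \<in> D"
  shows "c d = 0"
  using assms
proof (induction ps arbitrary: D c d)
  case Nil
  have "e = 1" if "e \<in> D" for e
    using Nil.prems(5)[OF that] by (metis emptyE list.set(1) prime_factor_nat)
  then have "D = {1}" "d = 1" using \<open>d \<in> D\<close> by auto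
  then show ?case using Nil.prems(7) by simp
next
  case (Cons p ps)
  note cl = real_subfield_closed[OF real_subfield_sqrt_tower[of ps]]
  have prp: "prime p" using Cons.prems by simp
  define D0 where "D0 = {d\<in>D. \<not> p dvd d}"
  define D1 where "D1 = {e. p * e \<in> D}"
  have D0: "finite D0" "D0 \<subseteq> D" using Cons.prems by (auto simp: D0_def)
  have D_eq: "D = D0 \<union> (*) p ` D1" "D0 \<inter> (*) p ` D1 = {}"
    by (auto simp: D0_def D1_def)
  have inj: "inj_on ((*) p) D1" using prp by (auto simp: inj_on_def)
  then have "finite D1" using finite_imageD[of "(*) p" D1] Cons.prems D_eq
    by (metis finite_Un)
  note fin = D0(1) this
  have pe: "\<not> p dvd e" if "e \<in> D1" for e
  proof
    assume "p dvd e"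
    then have "p^2 dvd p * e" unfolding power2_eq_square by (intro mult_dvd_mono) auto
    moreover have "squarefree (p * e)" using that Cons.prems by (auto simp: D1_def)
    ultimately show False using prp by (auto dest: squarefreeD)
  qed
  have sf0: "squarefree d" "c d \<in> \<rat>" "\<And>q. prime q \<Longrightarrow> q dvd d \<Longrightarrow> q \<in> set ps" if "d \<in> D0" for d
    using that Cons.prems(4-6)[of d] by (auto simp: D0_def)
  have sf1: "squarefree e" "c (p * e) \<in> \<rat>" "\<And>q. prime q \<Longrightarrow> q dvd e \<Longrightarrow> q \<in> set ps"
    if "e \<in> D1" for e
  proof -
    have pD: "p * e \<in> D" using that by (simp add: D1_def)
    show "squarefree e" using Cons.prems(4)[OF pD] by (rule squarefree_multD)
    show "c (p * e) \<in> \<rat>" using Cons.prems(6)[OF pD] .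
    show "q \<in> set ps" if "prime q" "q dvd e" for q
      using Cons.prems(5)[OF pD, of q] that pe[OF \<open>e \<in> D1\<close>] by auto
  qed
  define a where "a = (\<Sum>d\<in>D0. c d * sqrt d)"
  define b where "b = (\<Sum>e\<in>D1. c (p * e) * sqrt e)"
  have "(\<Sum>d\<in>D. c d * sqrt (real d)) = a + (\<Sum>d\<in>(*) p ` D1. c d * sqrt (real d))"
    unfolding a_def using fin D_eq by (subst D_eq(1), subst sum.union_disjoint) auto
  also have "(\<Sum>d\<in>(*) p ` D1. c d * sqrt (real d)) = b * sqrt p"
    unfolding b_def using inj
    by (subst sum.reindex) (auto simp: real_sqrt_mult sum_distrib_right intro!: sum.cong)
  finally have ab: "a + b * sqrt p = 0" using Cons.prems by simp
  have aK: "a \<in> sqrt_tower ps" unfolding a_def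
    using sf0 by (intro real_subfield_sum[OF real_subfield_sqrt_tower] cl(3))
      (auto intro: cl(1) sqrt_in_sqrt_tower)
  have bK: "b \<in> sqrt_tower ps" unfolding b_def
    using sf1 by (intro real_subfield_sum[OF real_subfield_sqrt_tower] cl(3))
      (auto intro: cl(1) sqrt_in_sqrt_tower)
  have b0: "b = 0"
  proof (rule ccontr)
    assume "b \<noteq> 0"
    with ab have "sqrt p = - a / b" by (simp add: field_simps add_eq_0_iff2)
    also have "\<dots> \<in> sqrt_tower ps" using aK bK by (intro cl(2-))
    finally have "sqrt p \<in> sqrt_tower ps" .
    moreover have "sqrt p \<notin> sqrt_tower ps"
    proof (rule sqrt_notin_sqrt_tower)
      show "\<not> q dvd p" if "q \<in> set ps" for q
        using primes_dvd_imp_eq[of q p] prp Cons.prems(1,2) that by auto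
      show "p \<noteq> 1" using prp by (metis not_prime_1)
    qed (use Cons.prems(1,2) squarefree_prime[OF prp] in auto)
    ultimately show False by simp
  qed
  with ab have a0: "a = 0" by simp
  have dist: "distinct ps" and pr: "\<And>q. q \<in> set ps \<Longrightarrow> prime q" using Cons.prems(1,2) by auto
  show ?case
  proof (cases "p dvd d")
    case False
    then have "d \<in> D0" using Cons.prems by (auto simp: D0_def)
    show ?thesis
    proof (rule Cons.IH[OF dist pr fin(1) sf0(1) sf0(3) sf0(2)])
      show "(\<Sum>d\<in>D0. c d * sqrt (real d)) = 0" using a0 by (simp add: a_def)
    qed (use \<open>d \<in> D0\<close> in auto)
  next
    case True
    then obtain e where e: "d = p * e" "e \<in> D1" using Cons.prems(8) by (auto simp: D1_def)
    have "c (p * e) = 0"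
    proof (rule Cons.IH[OF dist pr fin(2) sf1(1) sf1(3) sf1(2)])
      show "(\<Sum>e\<in>D1. c (p * e) * sqrt (real e)) = 0" using b0 by (simp add: b_def)
    qed (use e in auto)
    with e show ?thesis by simp
  qed
qed

lemma sqrt_squarefree_independent:
  assumes fin: "finite D" and sf: "\<And>d. d \<in> D \<Longrightarrow> squarefree (d :: nat)"
    and c: "\<And>d. d \<in> D \<Longrightarrow> c d \<in> \<rat>" and sum: "(\<Sum>d\<in>D. c d * sqrt (real d)) = 0"
    and d: "d \<in> D"
  shows "c d = 0"
proof -
  have "finite (\<Union>d\<in>D. prime_factors d)" using fin by auto
  then obtain ps where ps: "set ps = (\<Union>d\<in>D. prime_factors d)" "distinct ps"
    using finite_distinct_list by metis
  have [simp]: "0 \<notin> D" using sf[of 0] by auto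
  show ?thesis
  proof (rule sqrt_squarefree_independent_tower[OF ps(2) _ fin sf _ c sum d])
    show "prime p" if "p \<in> set ps" for p using that ps by auto
    show "p \<in> set ps" if "e \<in> D" "prime p" "p dvd e" for e p
    proof -
      have "e \<noteq> 0" using that(1) by (metis \<open>0 \<notin> D\<close>)
      then have "p \<in> prime_factors e" using that by (simp add: prime_factors_dvd)
      then show ?thesis unfolding ps using that(1) by blast
    qed
  qed
qed

text \<open>
  Kronecker's theorem for the numbers \<open>\<surd>d\<close>; the number 1 is excluded from \<open>D\<close>, since \<open>\<surd>1\<close> is the
  number modulo which the approximation takes place.
\<close>

lemma kronecker_sqrt_squarefree:
  fixes D :: "nat set" and \<alpha> :: "nat \<Rightarrow> real"
  assumes fin: "finite D" and sf: "\<And>d. d \<in> D \<Longrightarrow> squarefree d" and "1 \<notin> D" and "\<epsilon> > 0"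
  obtains k :: int and m :: "nat \<Rightarrow> int"
    where "\<And>d. d \<in> D \<Longrightarrow> \<bar>of_int k * sqrt d - of_int (m d) - \<alpha> d\<bar> < \<epsilon>"
proof -
  obtain f where f: "bij_betw f {..<card D} D"
    using ex_bij_betw_nat_finite[OF fin] by (auto simp: atLeast0LessThan)
  let ?n = "card D"
  define \<theta> where "\<theta> i = (if i < ?n then sqrt (f i) else 1)" for i
  have fD: "f i \<in> D" if "i < ?n" for i using f that by (auto simp: bij_betw_def)
  have f1: "f i \<noteq> 1" if "i < ?n" for i using fD[OF that] assms(3) by metis
  interpret Modules.module "\<lambda>r x :: real. of_int r * x"
    by unfold_locales (simp_all add: distrib_left distrib_right)
  have img: "\<theta> ` {..?n} = (\<lambda>d. sqrt (real d)) ` insert 1 D"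
  proof -
    have "{..?n} = insert ?n {..<?n}" by auto
    moreover have "\<theta> ` {..<?n} = (\<lambda>d. sqrt (real d)) ` f ` {..<?n}"
      unfolding image_image by (intro image_cong) (auto simp: \<theta>_def)
    moreover have "\<theta> ?n = 1" by (simp add: \<theta>_def)
    ultimately show ?thesis using f by (simp add: bij_betw_def)
  qed
  have inj: "inj_on \<theta> {..?n}"
    using f f1 by (auto simp: inj_on_def \<theta>_def bij_betw_def)
  have ind: "independent (\<theta> ` {..?n})"
    unfolding img independent_explicit_module
  proof safe
    fix T u v
    assume T: "finite T" "T \<subseteq> (\<lambda>d. sqrt (real d)) ` insert 1 D" "v \<in> T"
      and s: "(\<Sum>v\<in>T. of_int (u v) * v) = 0"
    obtain T' where T': "T' \<subseteq> insert 1 D" "T = (\<lambda>d. sqrt (real d)) ` T'"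
      using T(2) by (meson subset_image_iff)
    have "(\<Sum>d\<in>T'. of_int (u (sqrt d)) * sqrt d) = 0"
      using s unfolding T' by (subst (asm) sum.reindex) (auto simp: inj_on_def)
    moreover obtain d where d: "d \<in> T'" "v = sqrt d" using T T' by auto
    moreover have "finite T'" using T' fin by (auto intro: finite_subset)
    ultimately have "real_of_int (u (sqrt d)) = 0"
      using T'(1) sf
      by (intro sqrt_squarefree_independent[of T' "\<lambda>d. of_int (u (sqrt d))"]) auto
    with d show "u v = 0" by simp
  qed
  obtain k m where km: "\<And>i. i < ?n \<Longrightarrow> \<bar>of_int k * \<theta> i - of_int (m i) - \<alpha> (f i)\<bar> < \<epsilon>"
    using Kronecker_thm_2[OF ind inj _ \<open>\<epsilon> > 0\<close>, of "\<lambda>i. \<alpha> (f i)"] by (auto simp: \<theta>_def)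
  show thesis
  proof (rule that[of k "\<lambda>d. m (inv_into {..<?n} f d)"])
    fix d assume "d \<in> D"
    then obtain i where i: "i < ?n" "d = f i" using f by (auto simp: bij_betw_def)
    then show "\<bar>of_int k * sqrt d - of_int (m (inv_into {..<?n} f d)) - \<alpha> d\<bar> < \<epsilon>"
      using km[OF i(1)] f by (simp add: \<theta>_def bij_betw_def)
  qed
qed

section \<open>Simultaneous approximation of the phases\<close>

lemma norm_cis_diff_le: "norm (cis a - cis b) \<le> \<bar>a - b\<bar>"
proof -
  define h where "h = (a - b) / 2"
  have ab: "a - b = 2 * h" by (simp add: h_def)
  have "(norm (cis a - cis b))\<^sup>2 = (cos a - cos b)\<^sup>2 + (sin a - sin b)\<^sup>2"
    by (simp add: cmod_power2)
  also have "\<dots> = ((sin a)\<^sup>2 + (cos a)\<^sup>2) + ((sin b)\<^sup>2 + (cos b)\<^sup>2)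
      - 2 * (cos a * cos b + sin a * sin b)"
    by algebra
  also have "\<dots> = 2 - 2 * cos (2 * h)"
    unfolding ab[symmetric] cos_diff sin_cos_squared_add by simp
  also have "\<dots> = (2 * sin h)\<^sup>2"
    unfolding cos_double_sin by (simp add: power2_eq_square)
  also have "\<dots> \<le> (2 * h)\<^sup>2"
    using abs_sin_x_le_abs_x[of h] by (intro abs_le_square_iff[THEN iffD1]) (simp add: abs_mult)
  finally show ?thesis unfolding ab using power2_le_imp_le[of _ "\<bar>2 * h\<bar>"] by simp
qed

lemma cis_pi_odd:
  assumes "odd (n :: int)"
  shows "cis (pi * of_int n) = -1"
proof -
  obtain k where "n = 2 * k + 1" using assms by (rule oddE)
  then have "pi * of_int n = 2 * pi * of_int k + pi" by (simp add: algebra_simps)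
  then show ?thesis by (simp flip: cis_mult)
qed

text \<open>
  The hypothesis on \<open>\<omega>\<close> says that \<open>(4j + 1)\<surd>d\<close> may be replaced by any number \<open>4h + t\<close>, so that it is
  enough to approximate such numbers. For \<open>d = 1\<close> this is exact with \<open>h = j\<close> and \<open>t = 1\<close>.
\<close>

lemma kronecker_sqrt_simultaneous:
  fixes s d :: "real \<Rightarrow> nat" and c t :: real and \<omega> :: complex
  assumes fin: "finite S" and sf: "\<And>l. l \<in> S \<Longrightarrow> squarefree (d l)"
    and t: "\<And>l. l \<in> S \<Longrightarrow> d l = 1 \<Longrightarrow> t = 1" and "c > 0"
    and \<omega>: "\<And>l h :: int. l \<in> S \<Longrightarrow> cis (pi * (c * s l * (4 * of_int h + t))) = \<omega>" 
    and "\<delta> > 0"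
  shows "\<exists>j :: int. \<forall>l\<in>S. norm (cis (pi * (c * s l * ((4 * of_int j + 1) * sqrt (d l)))) - \<omega>) < \<delta>"
proof -
  define B where "B = 1 + (\<Sum>l\<in>S. pi * (c * s l))"
  have pos: "pi * (c * s l) \<ge> 0" for l using \<open>c > 0\<close> by simp
  then have B: "B > 0" unfolding B_def by (intro add_pos_nonneg sum_nonneg) auto
  have sB: "pi * (c * s l) \<le> B" if "l \<in> S" for l
    unfolding B_def using member_le_sum[OF that, of "\<lambda>l. pi * (c * s l)"] pos fin by force
  define D where "D = d ` S - {1}"
  have D: "finite D" "\<And>e. e \<in> D \<Longrightarrow> squarefree e" "1 \<notin> D" using fin sf by (auto simp: D_def)
  \<comment> \<open>The target \<open>(t - \<surd>d)/4\<close> for \<open>j\<surd>d\<close> modulo 1 makes \<open>(4j + 1)\<surd>d\<close> close to \<open>t\<close> modulo 4.\<close>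
  have "\<delta> / B / 4 > 0" using \<open>\<delta> > 0\<close> B by simp
  from kronecker_sqrt_squarefree[OF D this, of "\<lambda>e. (t - sqrt e) / 4"] obtain j m where jm:
    "\<And>e. e \<in> D \<Longrightarrow> \<bar>of_int j * sqrt e - of_int (m e) - (t - sqrt e) / 4\<bar> < \<delta> / B / 4"
    by blast
  have "norm (cis (pi * (c * s l * ((4 * of_int j + 1) * sqrt (d l)))) - \<omega>) < \<delta>"
    if l: "l \<in> S" for l
  proof -
    obtain h :: int where h: "\<bar>(4 * of_int j + 1) * sqrt (d l) - (4 * of_int h + t)\<bar> < \<delta> / B"
    proof (cases "d l = 1")
      case True
      then show ?thesis using that[of j] t[OF l] \<open>\<delta> > 0\<close> B by simp
    next
      case False
      then have "d l \<in> D" using l by (auto simp: D_def)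
      then have "4 * \<bar>of_int j * sqrt (d l) - of_int (m (d l)) - (t - sqrt (d l)) / 4\<bar> < \<delta> / B"
        using jm by fastforce
      also have "4 * \<bar>of_int j * sqrt (d l) - of_int (m (d l)) - (t - sqrt (d l)) / 4\<bar>
          = \<bar>4 * (of_int j * sqrt (d l) - of_int (m (d l)) - (t - sqrt (d l)) / 4)\<bar>"
        unfolding abs_mult by simp
      also have "4 * (of_int j * sqrt (d l) - of_int (m (d l)) - (t - sqrt (d l)) / 4)
          = (4 * of_int j + 1) * sqrt (d l) - (4 * of_int (m (d l)) + t)"
        by (simp add: field_simps)
      finally show ?thesis by (rule that)
    qed
    have "norm (cis (pi * (c * s l * ((4 * of_int j + 1) * sqrt (d l)))) - \<omega>)
        \<le> \<bar>pi * (c * s l * ((4 * of_int j + 1) * sqrt (d l))) - pi * (c * s l * (4 * of_int h + t))\<bar>"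
      unfolding \<omega>[OF l, of h, symmetric] by (rule norm_cis_diff_le)
    also have "\<dots> = \<bar>pi * (c * s l) * ((4 * of_int j + 1) * sqrt (d l) - (4 * of_int h + t))\<bar>"
      by (simp add: right_diff_distrib mult.assoc)
    also have "\<dots> = pi * (c * s l) * \<bar>(4 * of_int j + 1) * sqrt (d l) - (4 * of_int h + t)\<bar>"
      using abs_of_nonneg[OF pos[of l]] by (simp only: abs_mult[of "pi * (c * s l)"])
    also have "\<dots> \<le> B * \<bar>(4 * of_int j + 1) * sqrt (d l) - (4 * of_int h + t)\<bar>"
      using sB[OF l] by (intro mult_right_mono) auto
    also have "\<dots> < B * (\<delta> / B)" using h B by (intro mult_strict_left_mono)
    finally show ?thesis using B by simp
  qed
  then show ?thesis by blast
qed

lemma odd_square_mod_8: "odd (n :: int) \<Longrightarrow> n\<^sup>2 mod 8 = 1"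
proof -
  assume "odd n"
  then obtain k where k: "n = 2 * k + 1" by (rule oddE)
  have "even (k * (k + 1))" by simp
  then obtain i where i: "k * (k + 1) = 2 * i" by (rule evenE)
  have "n\<^sup>2 = 4 * (k * (k + 1)) + 1" unfolding k by (simp add: power2_eq_square algebra_simps)
  also have "\<dots> = 1 + 8 * i" unfolding i by simp
  finally show ?thesis by simp
qed

text \<open>
  The hypotheses mean that \<open>S\<close> consists of integers of the same parity. The sign \<open>\<omega>\<close> is \<open>-1\<close> if
  they are even and \<open>1\<close> if they are odd.
\<close>

lemma corona_phases_simultaneous:
  fixes S :: "real set"
  assumes fin: "finite S" and int: "\<And>l. l \<in> S \<Longrightarrow> l \<in> \<int>"
    and even: "\<And>l m. l \<in> S \<Longrightarrow> m \<in> S \<Longrightarrow> (l - m) / 2 \<in> \<int>"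
  shows "\<exists>\<omega>\<in>{1, -1}. \<forall>\<delta>>0. \<exists>j :: int. \<forall>l\<in>S.
    norm (cis ((4 * of_int j + 1) * pi * (sqrt (l\<^sup>2 + 4) / 2)) - \<omega>) < \<delta>"
proof (cases "\<forall>l\<in>S. l / 2 \<in> \<int>")
  case True
  define N where "N l = nat (\<lfloor>l / 2\<rfloor>\<^sup>2 + 1)" for l :: real
  define s where "s l = square_part (N l)" for l
  define d where "d l = squarefree_part (N l)" for l
  have dec: "N l = d l * (s l)\<^sup>2" for l unfolding s_def d_def by (rule squarefree_decompose)
  have root: "sqrt (l\<^sup>2 + 4) / 2 = s l * sqrt (d l)" if "l \<in> S" for l
  proof -
    have "real (N l) = (l / 2)\<^sup>2 + 1"
      using True that by (auto simp: N_def elim!: Ints_cases)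
    then have "l\<^sup>2 + 4 = 2\<^sup>2 * (real (d l) * (real (s l))\<^sup>2)"
      using dec[of l] by (simp add: field_simps)
    then show ?thesis by (simp add: real_sqrt_mult)
  qed
  have odd: "odd (s l)" for l
  proof
    assume "even (s l)"
    then have "4 dvd (s l)\<^sup>2" by (auto simp: power2_eq_square elim!: evenE)
    then have "4 dvd N l" unfolding dec by simp
    then have "int 4 dvd int (N l)" by (simp only: of_nat_dvd_iff)
    then have "4 dvd \<lfloor>l / 2\<rfloor>\<^sup>2 + 1" by (simp add: N_def)
    then have dvd: "4 dvd x\<^sup>2 + 1" if "x = \<lfloor>l / 2\<rfloor>" for x using that by simp
    show False
    proof (cases "even \<lfloor>l / 2\<rfloor>")
      case True
      then obtain k where "\<lfloor>l / 2\<rfloor> = 2 * k" by (rule evenE)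
      from dvd[OF this[symmetric]] have "4 dvd 4 * k\<^sup>2 + 1" by (simp add: power_mult_distrib)
      then show False by presburger
    next
      case False
      from odd_square_mod_8[OF this] \<open>4 dvd \<lfloor>l / 2\<rfloor>\<^sup>2 + 1\<close> show False by presburger
    qed
  qed
  show ?thesis
  proof (intro bexI[of _ "-1"] allI impI)
    fix \<delta> :: real assume "\<delta> > 0"
    have "\<exists>j :: int. \<forall>l\<in>S. norm (cis (pi * ((1::real) * real (s l) * ((4 * of_int j + 1) * sqrt (d l)))) - (-1)) < \<delta>"
    proof (rule kronecker_sqrt_simultaneous[OF fin _ _ _ _ \<open>\<delta> > 0\<close>, where t = 1])
      show "cis (pi * ((1::real) * real (s l) * (4 * of_int h + 1))) = -1" for l and h :: int
        using cis_pi_odd[of "int (s l) * (4 * h + 1)"] odd by simp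
    qed (auto simp: d_def)
    then show "\<exists>j :: int. \<forall>l\<in>S. norm (cis ((4 * of_int j + 1) * pi * (sqrt (l\<^sup>2 + 4) / 2)) - (-1)) < \<delta>"
      by (simp add: root mult_ac cong: ball_cong)
  qed simp
next
  case False
  then obtain l0 where l0: "l0 \<in> S" "l0 / 2 \<notin> \<int>" by blast
  define N where "N l = nat (\<lfloor>l\<rfloor>\<^sup>2 + 4)" for l :: real
  define s where "s l = square_part (N l)" for l
  define d where "d l = squarefree_part (N l)" for l
  have dec: "N l = d l * (s l)\<^sup>2" for l unfolding s_def d_def by (rule squarefree_decompose)
  have root: "sqrt (l\<^sup>2 + 4) = s l * sqrt (d l)" if "l \<in> S" for l
  proof -
    have "real (N l) = l\<^sup>2 + 4"
      using int[OF that] by (auto simp: N_def elim!: Ints_cases)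
    then have "l\<^sup>2 + 4 = real (d l) * (real (s l))\<^sup>2"
      using dec[of l] by (simp add: field_simps)
    then show ?thesis by (simp add: real_sqrt_mult)
  qed
  have d1: "d l \<noteq> 1" if l: "l \<in> S" for l
  proof
    assume "d l = 1"
    have "l / 2 \<notin> \<int>"
    proof
      assume "l / 2 \<in> \<int>"
      then have "l / 2 + (l0 - l) / 2 \<in> \<int>" using even[OF l0(1) l] by (rule Ints_add)
      then show False using l0 by (simp add: field_simps)
    qed
    have oddl: "odd \<lfloor>l\<rfloor>"
    proof
      assume "even \<lfloor>l\<rfloor>"
      then obtain k where "\<lfloor>l\<rfloor> = 2 * k" by (rule evenE)
      then have "l / 2 = of_int k" using int[OF l] by (auto elim!: Ints_cases)
      with \<open>l / 2 \<notin> \<int>\<close> show False by simp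
    qed
    have "int (N l) = (int (s l))\<^sup>2" using dec[of l] \<open>d l = 1\<close> by simp
    then have eq: "(int (s l))\<^sup>2 = \<lfloor>l\<rfloor>\<^sup>2 + 4" by (simp add: N_def)
    then have "odd ((int (s l))\<^sup>2)" using oddl by simp
    then have "odd (int (s l))" by simp
    from odd_square_mod_8[OF this] odd_square_mod_8[OF oddl] eq show False by presburger
  qed
  show ?thesis
  proof (intro bexI[of _ 1] allI impI)
    fix \<delta> :: real assume "\<delta> > 0"
    have "\<exists>j :: int. \<forall>l\<in>S. norm (cis (pi * (1/2 * s l * ((4 * of_int j + 1) * sqrt (d l)))) - 1) < \<delta>"
    proof (rule kronecker_sqrt_simultaneous[OF fin _ _ _ _ \<open>\<delta> > 0\<close>, where t = 0])
      show "cis (pi * (1/2 * s l * (4 * of_int h + 0))) = 1" for l and h :: int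
        using cis_multiple_2pi[of "of_int (int (s l) * h)"] by (simp add: mult_ac)
    qed (use d1 in \<open>auto simp: d_def\<close>)
    then show "\<exists>j :: int. \<forall>l\<in>S. norm (cis ((4 * of_int j + 1) * pi * (sqrt (l\<^sup>2 + 4) / 2)) - 1) < \<delta>"
      by (simp add: root mult_ac cong: ball_cong)
  qed simp
qed

section \<open>Eigenvector decompositions for real symmetric matrices\<close>

lemma symmetric_matrix_inner:
  fixes M :: "real^'n^'n"
  assumes "transpose M = M"
  shows "(M *v x) \<bullet> y = x \<bullet> (M *v y)"
  by (metis assms dot_lmul_matrix vector_transpose_matrix)

text \<open>
  A maximizer \<open>e\<close> of the Rayleigh quotient on the unit sphere of an invariant subspace is an
  eigenvector: the residual \<open>w = M e - \<mu> e\<close> lies in the subspace and is orthogonal to \<open>e\<close>, and the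
  first-order term of the quadratic form along \<open>e + t w\<close> is \<open>2 t (w \<bullet> w)\<close>, which has to vanish.
\<close>

lemma symmetric_matrix_eigenvector_in_subspace:
  fixes M :: "real^'n^'n"
  assumes sym: "transpose M = M" and V: "subspace V" "V \<noteq> {0}"
    and inv: "\<And>x. x \<in> V \<Longrightarrow> M *v x \<in> V"
  obtains e \<mu> where "e \<in> V" "norm e = 1" "M *v e = \<mu> *\<^sub>R e"
proof -
  let ?K = "V \<inter> sphere 0 1"
  have cont: "continuous_on ?K (\<lambda>x. (M *v x) \<bullet> x)"
    by (intro continuous_intros linear_continuous_on matrix_vector_mul_bounded_linear)
  have "compact ?K" using V by (intro closed_Int_compact closed_subspace) auto
  moreover have "?K \<noteq> {}"
  proof -
    obtain x where "x \<in> V" "x \<noteq> 0" using V subspace_0 by blast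
    then have "x /\<^sub>R norm x \<in> ?K" using V by (simp add: subspace_scale)
    then show ?thesis by blast
  qed
  ultimately obtain e where e: "e \<in> ?K"
    and max: "\<And>x. x \<in> ?K \<Longrightarrow> (M *v x) \<bullet> x \<le> (M *v e) \<bullet> e"
    using continuous_attains_sup[OF _ _ cont] by metis
  define \<mu> where "\<mu> = (M *v e) \<bullet> e"
  have ee: "e \<in> V" "norm e = 1" "e \<bullet> e = 1" using e by (auto simp: dot_square_norm)
  have max': "(M *v x) \<bullet> x \<le> \<mu> * (x \<bullet> x)" if "x \<in> V" for x
  proof (cases "x = 0")
    case False
    then have "x /\<^sub>R norm x \<in> ?K" using V that by (simp add: subspace_scale)
    from max[OF this] have "((M *v x) \<bullet> x) / (norm x)^2 \<le> \<mu>"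
      using False by (simp add: matrix_vector_mult_scaleR \<mu>_def power2_eq_square field_simps)
    then show ?thesis using False by (simp add: field_simps dot_square_norm)
  qed simp
  define w where "w = M *v e - \<mu> *\<^sub>R e"
  have wV: "w \<in> V" unfolding w_def using V ee inv by (intro subspace_diff subspace_scale) auto
  have we: "w \<bullet> e = 0" by (simp add: w_def inner_diff_left \<mu>_def ee)
  have ww: "(M *v e) \<bullet> w = w \<bullet> w"
    using we by (simp add: w_def inner_diff_left inner_diff_right inner_commute)
  define c where "c = (M *v w) \<bullet> w - \<mu> * (w \<bullet> w)"
  have key: "2 * t * (w \<bullet> w) + t^2 * c \<le> 0" for t
  proof -
    have le: "(M *v (e + t *\<^sub>R w)) \<bullet> (e + t *\<^sub>R w) \<le> \<mu> * ((e + t *\<^sub>R w) \<bullet> (e + t *\<^sub>R w))"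
      using V ee wV by (intro max' subspace_add subspace_scale) auto
    have lhs: "(M *v (e + t *\<^sub>R w)) \<bullet> (e + t *\<^sub>R w)
        = \<mu> + 2 * t * (w \<bullet> w) + t^2 * ((M *v w) \<bullet> w)"
      using symmetric_matrix_inner[OF sym, of w e] ww
      by (simp add: matrix_vector_right_distrib matrix_vector_mult_scaleR inner_add_left
          inner_add_right \<mu>_def power2_eq_square algebra_simps inner_commute)
    have rhs: "(e + t *\<^sub>R w) \<bullet> (e + t *\<^sub>R w) = 1 + t^2 * (w \<bullet> w)"
      using we ee by (simp add: inner_add_left inner_add_right power2_eq_square inner_commute)
    show ?thesis using le unfolding lhs rhs by (simp add: c_def algebra_simps)
  qed
  have "w \<bullet> w = 0"
  proof (rule ccontr)
    assume "w \<bullet> w \<noteq> 0"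
    then have pos: "w \<bullet> w > 0" by simp
    \<comment> \<open>This step is small enough for the linear term to dominate the quadratic one.\<close>
    define t where "t = (w \<bullet> w) / (1 + \<bar>c\<bar>)"
    have t: "t > 0" using pos by (simp add: t_def)
    have "t * \<bar>c\<bar> \<le> w \<bullet> w" unfolding t_def using pos by (simp add: field_simps)
    then have "t * (t * \<bar>c\<bar>) \<le> t * (w \<bullet> w)" using t by (intro mult_left_mono) auto
    moreover have "t * (t * - \<bar>c\<bar>) \<le> t * (t * c)" using t by (intro mult_left_mono) auto
    moreover have "t * (w \<bullet> w) > 0" using t pos by simp
    ultimately show False using key[of t] by (simp add: power2_eq_square algebra_simps)
  qed
  then have "M *v e = \<mu> *\<^sub>R e" by (simp add: w_def)
  with ee that show thesis by blast
qed

lemma symmetric_matrix_eigen_decomposition_in_subspace: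
  fixes M :: "real^'n^'n"
  assumes sym: "transpose M = M" and "subspace V" 
    and "\<And>x. x \<in> V \<Longrightarrow> M *v x \<in> V" and "x \<in> V"
  shows "\<exists>S y. finite S \<and> (\<forall>l. M *v y l = l *\<^sub>R y l) \<and> x = (\<Sum>l\<in>S. y l)"
  using assms(2-)
proof (induction "dim V" arbitrary: V x rule: less_induct)
  case less
  show ?case
  proof (cases "V = {0}")
    case True
    then show ?thesis using less.prems by (intro exI[of _ "{}"] exI[of _ "\<lambda>_. 0"]) auto
  next
    case False
    obtain e \<mu> where e: "e \<in> V" "norm e = 1" "M *v e = \<mu> *\<^sub>R e"
      using symmetric_matrix_eigenvector_in_subspace[OF sym less.prems(1) False less.prems(2)]
      by metis
    define W where "W = V \<inter> {w. e \<bullet> w = 0}"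
    have W: "subspace W" unfolding W_def
      using less.prems by (intro subspace_inter subspace_hyperplane)
    have "e \<bullet> e \<noteq> 0" using e(2) by auto
    then have "e \<notin> W" by (simp add: W_def)
    moreover have "W \<subseteq> V" by (simp add: W_def)
    ultimately have "W \<subset> V" using e(1) by blast
    then have "dim W < dim V"
      using W less.prems by (intro dim_psubset) (simp add: span_eq_iff[THEN iffD2])
    moreover have "M *v w \<in> W" if "w \<in> W" for w
      using that less.prems e symmetric_matrix_inner[OF sym, of e w] by (auto simp: W_def)
    moreover have "x - (e \<bullet> x) *\<^sub>R e \<in> W"
      using e less.prems
      by (auto simp: W_def inner_diff_right dot_square_norm intro!: subspace_diff subspace_scale)
    ultimately obtain S y where Sy: "finite S" "\<And>l. M *v y l = l *\<^sub>R y l"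
      "x - (e \<bullet> x) *\<^sub>R e = (\<Sum>l\<in>S. y l)"
      using less.hyps[of W "x - (e \<bullet> x) *\<^sub>R e"] W by metis
    define z where "z l = (if l \<in> S then y l else 0) + (if l = \<mu> then (e \<bullet> x) *\<^sub>R e else 0)" for l
    have "M *v z l = l *\<^sub>R z l" for l
      using Sy(2) e(3) by (simp add: z_def matrix_vector_right_distrib scaleR_add_right
          matrix_vector_mult_scaleR)
    moreover have "x = (\<Sum>l\<in>insert \<mu> S. z l)"
    proof -
      have "(\<Sum>l\<in>insert \<mu> S. z l) = (\<Sum>l\<in>insert \<mu> S. if l \<in> S then y l else 0) + (e \<bullet> x) *\<^sub>R e"
        unfolding z_def sum.distrib using Sy(1) by simp
      also have "(\<Sum>l\<in>insert \<mu> S. if l \<in> S then y l else 0) = (\<Sum>l\<in>S. y l)"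
        using Sy(1) by (intro sum.mono_neutral_cong_right) auto
      finally show ?thesis using Sy(3) by (simp add: algebra_simps)
    qed
    ultimately show ?thesis using Sy(1) by (intro exI[of _ "insert \<mu> S"] exI[of _ z]) auto
  qed
qed

text \<open>
  The summands are indexed by their eigenvalues. The family \<open>y\<close> is total: outside of the spectrum
  its values are zero, so the eigenvector equation and orthogonality hold for all indices.
\<close>

theorem symmetric_matrix_eigen_decomposition:
  fixes M :: "real^'n^'n"
  assumes sym: "transpose M = M"
  obtains S y where "finite S" "\<And>l. M *v y l = l *\<^sub>R y l" "\<And>l. l \<in> S \<Longrightarrow> y l \<noteq> 0"
    "x = (\<Sum>l\<in>S. y l)" "\<And>l m. l \<noteq> m \<Longrightarrow> y l \<bullet> y m = 0"
proof -
  obtain S y where Sy: "finite S" "\<And>l. M *v y l = l *\<^sub>R y l" "x = (\<Sum>l\<in>S. y l)"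
    using symmetric_matrix_eigen_decomposition_in_subspace[OF sym, of UNIV x] by auto
  have "y l \<bullet> y m = 0" if "l \<noteq> m" for l m
  proof -
    have "l * (y l \<bullet> y m) = m * (y l \<bullet> y m)"
      using symmetric_matrix_inner[OF sym, of "y l" "y m"] Sy(2) by simp
    with that show ?thesis by simp
  qed
  moreover have "x = (\<Sum>l\<in>{l\<in>S. y l \<noteq> 0}. y l)"
    unfolding Sy(3) using Sy(1) by (intro sum.mono_neutral_right) auto
  ultimately show thesis using Sy by (intro that[of "{l\<in>S. y l \<noteq> 0}" y]) auto
qed

section \<open>Integrality of the eigenvalues\<close>

lemma prod_linear_factors:
  fixes S :: "real set"
  assumes "finite S"
  defines "r \<equiv> \<Prod>a\<in>S. [:- a, 1:]"
  shows degree_prod_linear_factors: "degree r = card S"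
    and coeff_prod_linear_factors: "coeff r (card S) = 1"
    and coeff_prod_linear_factors_second: "S \<noteq> {} \<Longrightarrow> coeff r (card S - 1) = - \<Sum>S"
    and poly_prod_linear_factors: "x \<in> S \<Longrightarrow> poly r x = 0"
proof -
  show deg: "degree r = card S"
    unfolding r_def by (subst degree_prod_eq_sum_degree) auto
  show "x \<in> S \<Longrightarrow> poly r x = 0"
    unfolding r_def using assms(1) by (auto simp: poly_prod)
  have "coeff r (card S) = 1 \<and> (S \<noteq> {} \<longrightarrow> coeff r (card S - 1) = - \<Sum>S)"
    unfolding r_def using assms(1)
  proof (induction S rule: finite_induct)
    case empty
    then show ?case by simp
  next
    case (insert a S)
    have "degree (\<Prod>a\<in>S. [:- a, 1:]) = card S"
      by (subst degree_prod_eq_sum_degree) auto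
    then have "coeff (\<Prod>a\<in>S. [:- a, 1:]) (Suc (card S)) = 0"
      by (intro coeff_eq_0) simp
    moreover have "S = {}" if "card S = 0" using that insert by simp
    ultimately show ?case using insert
      by (cases "card S") (auto simp: coeff_pCons)
  qed
  then show "coeff r (card S) = 1" "S \<noteq> {} \<Longrightarrow> coeff r (card S - 1) = - \<Sum>S" by auto
qed

text \<open>
  If \<open>y\<^sub>l\<close> are linearly independent and all the moments \<open>\<Sum>\<^sub>l l\<^sup>k y\<^sub>l\<close> are integral, then the
  polynomial \<open>r = \<Prod>\<^sub>l (X - l)\<close> has rational coefficients. By Dirichlet's theorem some multiple
  \<open>q r\<close> is very close to an integer polynomial \<open>p\<close>. The vector \<open>\<Sum>\<^sub>l p(l) y\<^sub>l\<close> is then integral and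
  small, hence zero, so \<open>p\<close> vanishes on \<open>S\<close>; and so does \<open>T = q r - p\<close>, whose degree is less
  than the number of elements of \<open>S\<close>. Thus \<open>T = 0\<close>. Only the second coefficient \<open>- \<Sum>S\<close> is
  needed.
\<close>

lemma sum_spectrum_rational:
  fixes S :: "real set" and y :: "real \<Rightarrow> 'n::finite \<Rightarrow> real"
  assumes fin: "finite S"
    and ind: "\<And>c l. (\<And>x. (\<Sum>l\<in>S. c l * y l x) = 0) \<Longrightarrow> l \<in> S \<Longrightarrow> c l = 0"
    and int: "\<And>k x. (\<Sum>l\<in>S. l ^ k * y l x) \<in> \<int>"
  shows "\<Sum>S \<in> \<rat>"
proof (cases "S = {}")
  case False
  define m where "m = card S"
  have m: "m > 0" using False fin by (simp add: m_def card_gt_0_iff)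
  define r where "r = (\<Prod>a\<in>S. [:- a, 1:])"
  note r = prod_linear_factors[OF fin, folded r_def m_def]
  define M where "M k x = (\<Sum>l\<in>S. l ^ k * y l x)" for k x
  have Msum: "(\<Sum>j\<le>m. c j * M j x) = (\<Sum>l\<in>S. (\<Sum>j\<le>m. c j * l ^ j) * y l x)" for c x
    unfolding M_def sum_distrib_left sum_distrib_right
    by (subst sum.swap) (simp add: mult_ac)
  define B where "B = (\<Sum>x\<in>UNIV. \<Sum>j\<le>m. \<bar>M j x\<bar>)"
  have B0: "B \<ge> 0" unfolding B_def by (intro sum_nonneg) auto
  obtain N :: nat where N: "real N > B + 1" using reals_Archimedean2 by blast
  then have "N > 0" using B0 by (cases N) auto
  obtain q p where q: "0 < q"
    and qp: "\<And>j. j < Suc m \<Longrightarrow> \<bar>of_int q * coeff r j - of_int (p j)\<bar> < 1 / N"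
    using Dirichlet_approx_simult[OF \<open>N > 0\<close>, of "Suc m" "coeff r"] by metis
  have "p m = q"
  proof -
    have "\<bar>of_int q * 1 - real_of_int (p m)\<bar> < 1 / N" using qp[of m] r(2) by simp
    also have "1 / real N \<le> 1" using \<open>N > 0\<close> by simp
    finally have "\<bar>real_of_int (q - p m)\<bar> < 1" by simp
    then have "\<bar>q - p m\<bar> < 1" by linarith
    then show ?thesis by simp
  qed
  have root: "(\<Sum>j\<le>m. coeff r j * l ^ j) = 0" if "l \<in> S" for l
    using r(4)[OF that] by (simp add: poly_altdef r(1))
  have zero: "(\<Sum>j\<le>m. real_of_int (p j) * M j x) = 0" for x
  proof -
    have "(\<Sum>j\<le>m. coeff r j * M j x) = 0" unfolding Msum using root by simp
    then have "(\<Sum>j\<le>m. real_of_int (p j) * M j x)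
        = - (\<Sum>j\<le>m. (of_int q * coeff r j - of_int (p j)) * M j x)"
      by (simp add: left_diff_distrib sum_subtractf mult.assoc flip: sum_distrib_left)
    then have "\<bar>\<Sum>j\<le>m. real_of_int (p j) * M j x\<bar>
        \<le> (\<Sum>j\<le>m. \<bar>(of_int q * coeff r j - of_int (p j)) * M j x\<bar>)"
      by (simp only: abs_minus_cancel) (rule sum_abs)
    also have "\<dots> \<le> (\<Sum>j\<le>m. 1 / N * \<bar>M j x\<bar>)"
    proof (rule sum_mono)
      fix j assume "j \<in> {..m}"
      then have "\<bar>of_int q * coeff r j - of_int (p j)\<bar> \<le> 1 / N"
        using qp[of j] by simp
      then show "\<bar>(of_int q * coeff r j - of_int (p j)) * M j x\<bar> \<le> 1 / N * \<bar>M j x\<bar>"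
        unfolding abs_mult by (rule mult_right_mono) simp
    qed
    also have "\<dots> = (\<Sum>j\<le>m. \<bar>M j x\<bar>) / N" by (simp add: sum_divide_distrib)
    also have "(\<Sum>j\<le>m. \<bar>M j x\<bar>) \<le> B" unfolding B_def
      by (rule member_le_sum) (auto intro: sum_nonneg)
    also have "B / N < 1" using N B0 by (simp add: field_simps)
    finally have "\<bar>\<Sum>j\<le>m. real_of_int (p j) * M j x\<bar> < 1"
      using \<open>N > 0\<close> by (simp add: divide_right_mono)
    moreover have "(\<Sum>j\<le>m. real_of_int (p j) * M j x) \<in> \<int>"
      using int by (intro Ints_sum Ints_mult) (auto simp: M_def)
    ultimately show ?thesis by (metis Ints_nonzero_abs_less1)
  qed
  have P: "(\<Sum>j\<le>m. real_of_int (p j) * l ^ j) = 0" if "l \<in> S" for l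
    using zero that unfolding Msum by (rule ind)
  define T where "T = (\<Sum>j<m. monom (of_int q * coeff r j - of_int (p j)) j)"
  have coeffT: "coeff T j = (if j < m then of_int q * coeff r j - of_int (p j) else 0)" for j
    unfolding T_def by (simp add: coeff_sum sum.delta)
  have "poly T l = 0" if "l \<in> S" for l
  proof -
    have "poly T l = (\<Sum>j<m. (of_int q * coeff r j - of_int (p j)) * l ^ j)"
      by (simp add: T_def poly_sum poly_monom)
    also have "\<dots> = (\<Sum>j\<le>m. (of_int q * coeff r j - of_int (p j)) * l ^ j)"
      using \<open>p m = q\<close> r(2) by (simp flip: lessThan_Suc_atMost)
    also have "\<dots> = 0" using root[OF that] P[OF that]
      by (simp add: left_diff_distrib sum_subtractf mult.assoc flip: sum_distrib_left)
    finally show ?thesis .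
  qed
  then have sub: "S \<subseteq> {x. poly T x = 0}" by blast
  have "T = 0"
  proof (rule ccontr)
    assume T: "T \<noteq> 0"
    have "m \<le> card {x. poly T x = 0}"
      unfolding m_def using sub poly_roots_finite[OF T] by (rule card_mono[rotated])
    also have "\<dots> \<le> degree T" by (rule card_poly_roots_bound[OF T])
    also have "degree T \<le> m - 1" using coeffT by (intro degree_le) auto
    finally show False using m by simp
  qed
  then have "of_int q * coeff r (m - 1) = of_int (p (m - 1))"
    using coeffT[of "m - 1"] m by simp
  then have "\<Sum>S = - of_int (p (m - 1)) / of_int q"
    using r(3)[OF False] q by (simp add: field_simps)
  then show ?thesis by (simp add: Rats_divide)
qed simp

lemma rational_Ints_of_scaled_powers:
  fixes l z :: real
  assumes "l \<in> \<rat>" "z \<noteq> 0" "\<And>k. z * l ^ k \<in> \<int>"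
  shows "l \<in> \<int>"
proof -
  obtain a b :: int where ab: "b > 0" "coprime a b" "l = of_int a / of_int b"
    using assms(1) by (metis Rats_cases')
  obtain w :: int where w: "z = of_int w" using assms(3)[of 0] by (auto elim: Ints_cases)
  define k where "k = nat \<bar>w\<bar>"
  obtain v :: int where v: "z * l ^ k = of_int v" using assms(3)[of k] by (auto elim: Ints_cases)
  have "real_of_int (w * a ^ k) = of_int (v * b ^ k)"
    using v ab unfolding w by (simp add: power_divide field_simps)
  then have "w * a ^ k = v * b ^ k" by (simp only: of_int_eq_iff)
  then have "b ^ k dvd w * a ^ k" by simp
  then have "b ^ k dvd w"
    using ab(2) by (simp add: coprime_dvd_mult_left_iff coprime_commute)
  then have le: "b ^ k \<le> \<bar>w\<bar>" using assms(2) w by (intro dvd_imp_le_int[of w "b ^ k", THEN order_trans[rotated]]) auto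
  have "b = 1"
  proof (rule ccontr)
    assume "b \<noteq> 1"
    then have "2 ^ k \<le> b ^ k" using ab by (intro power_mono) auto
    moreover have "int k < 2 ^ k" by (metis of_nat_less_two_power)
    ultimately show False using le by (simp add: k_def)
  qed
  then show ?thesis using ab by simp
qed

text \<open>
  The sum of \<open>S\<close> is rational and the differences are integers, so every \<open>l\<close> is rational. Applying
  \<open>\<Prod>\<^bsub>t \<noteq> l\<^esub> (b A - b t)\<close>, with \<open>b\<close> a common denominator, to the moments isolates a nonzero multiple of
  \<open>y\<^sub>l\<close>, all of whose products with powers of \<open>l\<close> are integral. This bounds the denominator of \<open>l\<close>.
\<close>

lemma spectrum_integral:
  fixes S :: "real set" and y :: "real \<Rightarrow> 'n::finite \<Rightarrow> real"
  assumes fin: "finite S"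
    and ind: "\<And>c l. (\<And>x. (\<Sum>l\<in>S. c l * y l x) = 0) \<Longrightarrow> l \<in> S \<Longrightarrow> c l = 0"
    and int: "\<And>k x. (\<Sum>l\<in>S. l ^ k * y l x) \<in> \<int>"
    and diff: "\<And>l m. l \<in> S \<Longrightarrow> m \<in> S \<Longrightarrow> l - m \<in> \<int>"
    and "l \<in> S"
  shows "l \<in> \<int>"
proof -
  have "(\<Sum>m\<in>S. l - m) \<in> \<rat>"
    using diff[OF \<open>l \<in> S\<close>] Ints_subset_Rats by (intro Rats_sum) auto
  moreover have "\<Sum>S \<in> \<rat>" using fin ind int by (rule sum_spectrum_rational)
  moreover have "l = ((\<Sum>m\<in>S. l - m) + \<Sum>S) / real (card S)"
    using fin \<open>l \<in> S\<close> by (auto simp: sum_subtractf)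
  ultimately have rat: "l \<in> \<rat>" by (metis Rats_add Rats_divide Rats_of_nat)
  then obtain a b :: int where ab: "b > 0" "l = of_int a / of_int b" by (metis Rats_cases')
  have bS: "of_int b * m \<in> \<int>" if "m \<in> S" for m
  proof -
    have "of_int b * m = of_int a - of_int b * (l - m)" using ab by (simp add: field_simps)
    also have "\<dots> \<in> \<int>" using diff[OF \<open>l \<in> S\<close> that] by auto
    finally show ?thesis .
  qed
  have T: "(\<Sum>m\<in>S. (\<Prod>t\<in>T. of_int b * m - of_int b * t) * m ^ k * y m x) \<in> \<int>"
    if "T \<subseteq> S" for T k x
    using finite_subset[OF that fin] that
  proof (induction T arbitrary: k rule: finite_induct)
    case empty
    then show ?case using int by simp
  next
    case (insert s T)
    let ?f = "\<lambda>k. \<Sum>m\<in>S. (\<Prod>t\<in>T. of_int b * m - of_int b * t) * m ^ k * y m x"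
    have "(\<Sum>m\<in>S. (\<Prod>t\<in>insert s T. of_int b * m - of_int b * t) * m ^ k * y m x)
        = of_int b * ?f (Suc k) - of_int b * s * ?f k"
      using insert by (simp add: sum_distrib_left algebra_simps flip: sum_subtractf)
    also have "\<dots> \<in> \<int>"
    proof -
      have f: "?f k \<in> \<int>" "?f (Suc k) \<in> \<int>" using insert.prems by (blast intro: insert.IH)+
      have "of_int b * ?f (Suc k) \<in> \<int>" by (rule Ints_mult[OF Ints_of_int f(2)])
      moreover have "of_int b * s * ?f k \<in> \<int>"
        using insert.prems by (intro Ints_mult[of "of_int b * s"] bS f(1)) auto
      ultimately show ?thesis by (rule Ints_diff)
    qed
    finally show ?case .
  qed
  define C where "C = (\<Prod>t\<in>S - {l}. of_int b * l - of_int b * t)"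
  have "C \<noteq> 0" unfolding C_def using fin ab by auto
  have coll: "C * y l x * l ^ k \<in> \<int>" for k x
  proof -
    have "(\<Prod>t\<in>S - {l}. of_int b * m - of_int b * t) = 0" if "m \<in> S - {l}" for m
      using that fin by (intro prod_zero) auto
    then have "(\<Sum>m\<in>S. (\<Prod>t\<in>S - {l}. of_int b * m - of_int b * t) * m ^ k * y m x)
      = (\<Sum>m\<in>{l}. (\<Prod>t\<in>S - {l}. of_int b * m - of_int b * t) * m ^ k * y m x)"
      using fin \<open>l \<in> S\<close> by (intro sum.mono_neutral_right) auto
    then show ?thesis using T[of "S - {l}" k x] by (simp add: C_def mult_ac)
  qed
  obtain x where "y l x \<noteq> 0"
  proof (rule ccontr)
    assume "\<not> thesis"
    then have "y l x = 0" for x using that by blast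
    then have "(\<Sum>m\<in>S. (if m = l then 1 else 0) * y m x) = 0" for x
      by (intro sum.neutral) auto
    from ind[OF this \<open>l \<in> S\<close>] show False by simp
  qed
  then have "C * y l x \<noteq> 0" using \<open>C \<noteq> 0\<close> by simp
  then show ?thesis using coll by (rule rational_Ints_of_scaled_powers[OF rat])
qed

section \<open>Transition matrices and perfect state transfer\<close>

text \<open>
  The adjacency matrix over the reals, and the embedding of real vectors into the complex ones.
  Spectral theory is done over the reals, so that the eigenvectors are real.
\<close>

definition real_adj_matrix :: "('a::finite \<Rightarrow> 'a \<Rightarrow> bool) \<Rightarrow> real^'a^'a" where
  "real_adj_matrix G = (\<chi> a b. if G a b then 1 else 0)"

definition complex_vec :: "real^'n \<Rightarrow> complex^'n" where
  "complex_vec x = (\<chi> i. of_real (x $ i))"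

lemma complex_vec_nth [simp]: "complex_vec x $ i = of_real (x $ i)"
  by (simp add: complex_vec_def)

lemma complex_vec_scaleR: "complex_vec (c *\<^sub>R x) = of_real c *s complex_vec x"
  by (simp add: vec_eq_iff)

lemma complex_vec_sum: "complex_vec (\<Sum>l\<in>S. y l) = (\<Sum>l\<in>S. complex_vec (y l))"
  by (simp add: vec_eq_iff)

lemma complex_vec_axis: "complex_vec (axis i 1) = axis i 1"
  by (simp add: vec_eq_iff axis_def)

lemma adj_matrix_complex_vec:
  "adj_matrix G *v complex_vec x = complex_vec (real_adj_matrix G *v x)"
  by (simp add: vec_eq_iff adj_matrix_def real_adj_matrix_def matrix_vector_mult_def
      if_distrib if_distribR cong: if_cong)

lemma transpose_real_adj_matrix:
  assumes "simple_graph G"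
  shows "transpose (real_adj_matrix G) = real_adj_matrix G"
  using assms by (auto simp: simple_graph_def symp_def transpose_def real_adj_matrix_def vec_eq_iff)

lemma matrix_power_eigenvector:
  assumes "M *v z = c *s z"
  shows "matrix_power M k *v z = (c ^ k) *s z"
proof (induction k)
  case 0
  then show ?case by simp
next
  case (Suc k)
  have "matrix_power M (Suc k) *v z = M *v (c ^ k *s z)"
    by (simp add: matrix_vector_mul_assoc[symmetric] Suc)
  also have "\<dots> = c ^ k *s (M *v z)" by (rule vector_scalar_commute)
  finally show ?case by (simp add: assms vec_eq_iff)
qed

lemma matrix_exp_eigenvector:
  fixes M :: "complex^'n^'n"
  assumes "M *v z = c *s z"
  shows "matrix_exp M *v z = exp c *s z"
proof -
  have bl: "bounded_linear (\<lambda>A :: complex^'n^'n. (A *v z) $ i)" for i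
    by (intro linear_conv_bounded_linear[THEN iffD1] linearI)
      (simp_all add: matrix_vector_mult_def scaleR_sum_right sum.distrib algebra_simps)
  have "(matrix_exp M *v z) $ i = exp c * z $ i" for i
  proof -
    have "(\<lambda>k. (((matrix_power M k /\<^sub>R fact k)) *v z) $ i) sums (matrix_exp M *v z) $ i"
      unfolding matrix_exp_def
      by (intro bounded_linear.sums[OF bl] summable_sums summable_matrix_exp)
    moreover have "(((matrix_power M k /\<^sub>R fact k)) *v z) $ i = (c ^ k /\<^sub>R fact k) * z $ i" for k
    proof -
      have "(matrix_power M k /\<^sub>R fact k) *v z = (matrix_power M k *v z) /\<^sub>R fact k"
        by (simp add: vec_eq_iff matrix_vector_mult_def scaleR_sum_right)
      then show ?thesis by (simp add: matrix_power_eigenvector[OF assms])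
    qed
    moreover have "(\<lambda>k. (c ^ k /\<^sub>R fact k) * z $ i) sums (exp c * z $ i)"
      by (intro sums_mult2 exp_converges)
    ultimately show ?thesis by (simp add: sums_unique2)
  qed
  then show ?thesis by (simp add: vec_eq_iff)
qed

lemma transition_matrix_eigenvector:
  assumes "adj_matrix X *v z = complex_of_real \<theta> *s z"
  shows "transition_matrix X \<tau> *v z = cis (- (\<tau> * \<theta>)) *s z"
proof -
  have "map_matrix (\<lambda>w. - \<i> * of_real \<tau> * w) (adj_matrix X) *v z
      = (- \<i> * of_real \<tau>) *s (adj_matrix X *v z)"
    by (simp add: vec_eq_iff matrix_vector_mult_def map_matrix_def sum_distrib_left mult_ac sum_negf)
  also have "\<dots> = (- \<i> * of_real (\<tau> * \<theta>)) *s z"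
    by (simp add: assms vec_eq_iff)
  finally have "transition_matrix X \<tau> *v z = exp (- \<i> * of_real (\<tau> * \<theta>)) *s z"
    unfolding transition_matrix_def by (rule matrix_exp_eigenvector)
  then show ?thesis by (simp add: cis_conv_exp)
qed

lemma transition_matrix_spectral_sum:
  assumes "\<And>l. l \<in> S \<Longrightarrow> real_adj_matrix X *v y l = l *\<^sub>R y l"
  shows "transition_matrix X \<tau> *v complex_vec (\<Sum>l\<in>S. y l)
    = (\<Sum>l\<in>S. cis (- (\<tau> * l)) *s complex_vec (y l))"
proof -
  have "transition_matrix X \<tau> *v complex_vec (y l) = cis (- (\<tau> * l)) *s complex_vec (y l)"
    if "l \<in> S" for l
    using assms[OF that]
    by (intro transition_matrix_eigenvector) (simp only: adj_matrix_complex_vec complex_vec_scaleR)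
  then show ?thesis by (simp add: complex_vec_sum vec.sum)
qed

text \<open>
  By unitarity \<open>e\<^bsup>-i\<tau>A\<^esup> e\<^sub>u\<close> equals \<open>\<gamma> e\<^sub>v\<close> and not only its entry at \<open>v\<close> has modulus 1. Taking the inner
  product with \<open>y\<^sub>l\<close> gives \<open>e\<^bsup>-i\<tau>l\<^esup> = \<gamma> \<sigma>\<^sub>l\<close>, where \<open>\<sigma>\<^sub>l = y\<^sub>l(v) / \<parallel>y\<^sub>l\<parallel>\<^sup>2\<close> is real and of modulus 1. In
  the proof \<open>a\<close> and \<open>-b\<close> are the real and the imaginary part of \<open>e\<^bsup>-i\<tau>A\<^esup> e\<^sub>u\<close>.
\<close>

lemma perfect_state_transfer_spectral:
  fixes G :: "'a::finite \<Rightarrow> 'a \<Rightarrow> bool"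
  assumes pst: "perfect_state_transfer G \<tau> u v"
    and fin: "finite S" and eig: "\<And>l. real_adj_matrix G *v y l = l *\<^sub>R y l"
    and nz: "\<And>l. l \<in> S \<Longrightarrow> y l \<noteq> 0" and u: "axis u 1 = (\<Sum>l\<in>S. y l)"
    and orth: "\<And>l m. l \<noteq> m \<Longrightarrow> y l \<bullet> y m = 0"
  shows "\<exists>(\<gamma> :: complex) (\<sigma> :: real \<Rightarrow> real). norm \<gamma> = 1 \<and> (\<forall>l\<in>S. \<sigma> l \<in> {1, -1}) \<and>
    (\<forall>l\<in>S. cis (- (\<tau> * l)) = \<gamma> * of_real (\<sigma> l)) \<and> axis v 1 = (\<Sum>l\<in>S. \<sigma> l *\<^sub>R y l)"
proof -
  define a where "a = (\<Sum>l\<in>S. cos (\<tau> * l) *\<^sub>R y l)"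
  define b where "b = (\<Sum>l\<in>S. sin (\<tau> * l) *\<^sub>R y l)"
  have norm_comb: "(norm (\<Sum>l\<in>S. c l *\<^sub>R y l))\<^sup>2 = (\<Sum>l\<in>S. (c l)\<^sup>2 * (norm (y l))\<^sup>2)" for c
  proof -
    have "pairwise (\<lambda>i j. orthogonal (c i *\<^sub>R y i) (c j *\<^sub>R y j)) S"
      unfolding pairwise_def orthogonal_def using orth by simp
    from norm_sum_Pythagorean[OF fin this] show ?thesis by (simp add: power_mult_distrib)
  qed
  have inner_comb: "(\<Sum>l\<in>S. c l *\<^sub>R y l) \<bullet> y m = c m * (norm (y m))\<^sup>2" if "m \<in> S" for c m
  proof -
    have "(\<Sum>l\<in>S. c l *\<^sub>R y l) \<bullet> y m = (\<Sum>l\<in>S. if l = m then c m * (norm (y m))\<^sup>2 else 0)"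
      unfolding inner_sum_left by (intro sum.cong) (auto simp: orth power2_norm_eq_inner)
    then show ?thesis using fin that by simp
  qed
  have ab1: "(norm a)\<^sup>2 + (norm b)\<^sup>2 = 1"
  proof -
    have "(norm a)\<^sup>2 + (norm b)\<^sup>2 = (\<Sum>l\<in>S. 1\<^sup>2 * (norm (y l))\<^sup>2)"
      unfolding a_def b_def norm_comb by (simp flip: sum.distrib distrib_right)
    also have "\<dots> = (norm (\<Sum>l\<in>S. 1 *\<^sub>R y l))\<^sup>2" unfolding norm_comb ..
    also have "\<dots> = 1" using u by (simp flip: u)
    finally show ?thesis .
  qed
  have "(transition_matrix G \<tau> *v axis u 1) $ v = Complex (a $ v) (- (b $ v))"
    unfolding complex_vec_axis[symmetric] u transition_matrix_spectral_sum[OF eig]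
    by (simp add: a_def b_def complex_eq_iff Re_sum Im_sum sum_negf)
  then have v1: "(a $ v)\<^sup>2 + (b $ v)\<^sup>2 = 1"
    using pst by (simp add: perfect_state_transfer_def cmod_def)
  have sq: "(norm w)\<^sup>2 = (\<Sum>x\<in>UNIV. (w $ x)\<^sup>2)" for w :: "real^'a"
    by (simp add: norm_vec_def L2_set_def sum_nonneg)
  have off: "a $ x = 0 \<and> b $ x = 0" if "x \<noteq> v" for x
  proof -
    have "(a $ v)\<^sup>2 + (a $ x)\<^sup>2 + ((b $ v)\<^sup>2 + (b $ x)\<^sup>2)
        = (\<Sum>z\<in>{v, x}. (a $ z)\<^sup>2) + (\<Sum>z\<in>{v, x}. (b $ z)\<^sup>2)" using that by simp
    also have "\<dots> \<le> (norm a)\<^sup>2 + (norm b)\<^sup>2"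
      unfolding sq by (intro add_mono sum_mono2) auto
    finally have "(a $ x)\<^sup>2 + (b $ x)\<^sup>2 \<le> 0" using v1 ab1 by simp
    then show ?thesis by (simp add: sum_power2_le_zero_iff)
  qed
  have a: "a = (a $ v) *\<^sub>R axis v 1" and b: "b = (b $ v) *\<^sub>R axis v 1"
    using off by (auto simp: vec_eq_iff axis_def)
  define \<sigma> where "\<sigma> l = y l $ v / (norm (y l))\<^sup>2" for l
  have cs: "cos (\<tau> * l) = a $ v * \<sigma> l" "sin (\<tau> * l) = b $ v * \<sigma> l" if "l \<in> S" for l
  proof -
    have "a \<bullet> y l = a $ v * y l $ v"
      by (rule trans[OF arg_cong[OF a, of "\<lambda>w. w \<bullet> y l"]]) (simp add: inner_axis')
    moreover have "a \<bullet> y l = cos (\<tau> * l) * (norm (y l))\<^sup>2"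
      unfolding a_def by (rule inner_comb[OF that])
    ultimately have c_eq: "cos (\<tau> * l) * (norm (y l))\<^sup>2 = a $ v * y l $ v" by simp
    show "cos (\<tau> * l) = a $ v * \<sigma> l"
      using c_eq nz[OF that] by (simp add: \<sigma>_def eq_divide_eq)
    have "b \<bullet> y l = b $ v * y l $ v"
      by (rule trans[OF arg_cong[OF b, of "\<lambda>w. w \<bullet> y l"]]) (simp add: inner_axis')
    moreover have "b \<bullet> y l = sin (\<tau> * l) * (norm (y l))\<^sup>2"
      unfolding b_def by (rule inner_comb[OF that])
    ultimately have s_eq: "sin (\<tau> * l) * (norm (y l))\<^sup>2 = b $ v * y l $ v" by simp
    show "sin (\<tau> * l) = b $ v * \<sigma> l"
      using s_eq nz[OF that] by (simp add: \<sigma>_def eq_divide_eq)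
  qed
  show ?thesis
  proof (intro exI[of _ "Complex (a $ v) (- (b $ v))"] exI[of _ \<sigma>] conjI ballI)
    show "norm (Complex (a $ v) (- (b $ v))) = 1" using v1 by (simp add: cmod_def)
  next
    fix l assume l: "l \<in> S"
    have "(\<sigma> l)\<^sup>2 = ((a $ v)\<^sup>2 + (b $ v)\<^sup>2) * (\<sigma> l)\<^sup>2" using v1 by simp
    also have "\<dots> = (sin (\<tau> * l))\<^sup>2 + (cos (\<tau> * l))\<^sup>2"
      unfolding cs[OF l] by (simp add: algebra_simps power_mult_distrib)
    finally show "\<sigma> l \<in> {1, -1}" by (simp add: power2_eq_1_iff)
    show "cis (- (\<tau> * l)) = Complex (a $ v) (- (b $ v)) * of_real (\<sigma> l)"
      by (simp add: complex_eq_iff cs[OF l])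
  next
    have "axis v 1 = ((a $ v)\<^sup>2 + (b $ v)\<^sup>2) *\<^sub>R (axis v 1 :: real^'a)" using v1 by simp
    also have "\<dots> = (a $ v) *\<^sub>R ((a $ v) *\<^sub>R axis v 1) + (b $ v) *\<^sub>R ((b $ v) *\<^sub>R axis v 1)"
      by (simp add: scaleR_add_left power2_eq_square)
    also have "\<dots> = (a $ v) *\<^sub>R a + (b $ v) *\<^sub>R b" by (simp only: a[symmetric] b[symmetric])
    also have "\<dots> = (\<Sum>l\<in>S. (a $ v * cos (\<tau> * l) + b $ v * sin (\<tau> * l)) *\<^sub>R y l)"
      unfolding a_def b_def by (simp add: scaleR_sum_right scaleR_add_left sum.distrib)
    also have "\<dots> = (\<Sum>l\<in>S. \<sigma> l *\<^sub>R y l)"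
    proof (intro sum.cong refl)
      fix l assume "l \<in> S"
      have "a $ v * (a $ v * \<sigma> l) + b $ v * (b $ v * \<sigma> l) = ((a $ v)\<^sup>2 + (b $ v)\<^sup>2) * \<sigma> l"
        by (simp add: power2_eq_square algebra_simps)
      then show "(a $ v * cos (\<tau> * l) + b $ v * sin (\<tau> * l)) *\<^sub>R y l = \<sigma> l *\<^sub>R y l"
        using cs[OF \<open>l \<in> S\<close>] v1 by simp
    qed
    finally show "axis v 1 = (\<Sum>l\<in>S. \<sigma> l *\<^sub>R y l)" .
  qed
qed

text \<open>
  These are the entries of \<open>A\<^sup>k e\<^sub>u\<close>, that is, numbers of walks.
\<close>

lemma vertex_moments_integral:
  fixes G :: "'a::finite \<Rightarrow> 'a \<Rightarrow> bool"
  assumes eig: "\<And>l. real_adj_matrix G *v y l = l *\<^sub>R y l" and u: "axis u 1 = (\<Sum>l\<in>S. y l)"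
  shows "(\<Sum>l\<in>S. l ^ k * y l $ x) \<in> \<int>"
proof (induction k arbitrary: x)
  case 0
  have "(\<Sum>l\<in>S. l ^ 0 * y l $ x) = axis u 1 $ x" unfolding u by simp
  then show ?case by (simp add: axis_def)
next
  case (Suc k)
  have "(\<Sum>l\<in>S. l ^ Suc k * y l $ x) = (real_adj_matrix G *v (\<Sum>l\<in>S. l ^ k *\<^sub>R y l)) $ x"
    by (simp add: matrix_vector_mult_scaleR eig mult_ac vec.sum)
  also have "\<dots> = (\<Sum>z\<in>UNIV. (if G x z then 1 else 0) * (\<Sum>l\<in>S. l ^ k * y l $ z))"
    by (simp add: matrix_vector_mult_def real_adj_matrix_def)
  also have "\<dots> \<in> \<int>" by (intro Ints_sum Ints_mult[OF _ Suc]) auto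
  finally show ?case .
qed

section \<open>Eigenvectors of the corona\<close>

text \<open>
  The vector \<open>(\<theta> y, y)\<close> on the corona with \<open>K\<^sub>1\<close>: \<open>\<theta> y\<close> on the copy of \<open>G\<close> and \<open>y\<close> on the pendant
  vertices.
\<close>

definition corona_lift :: "real \<Rightarrow> real^'a \<Rightarrow> real^('a \<times> unit option)" where
  "corona_lift \<theta> y = (\<chi> p. if snd p = None then \<theta> * y $ fst p else y $ fst p)"

lemma corona_K1_eigenvector:
  fixes G :: "'a::finite \<Rightarrow> 'a \<Rightarrow> bool"
  assumes "real_adj_matrix G *v y = l *\<^sub>R y" "\<theta>\<^sup>2 = l * \<theta> + 1"
  shows "real_adj_matrix (corona G K1) *v corona_lift \<theta> y = \<theta> *\<^sub>R corona_lift \<theta> y"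
proof -
  have UN: "(UNIV :: unit option set) = {None, Some ()}" by (auto simp: UNIV_option_conv)
  have S: "(\<Sum>p\<in>UNIV. f p) = (\<Sum>x\<in>UNIV. f (x, None)) + (\<Sum>x\<in>UNIV. f (x, Some ()))"
    for f :: "'a \<times> unit option \<Rightarrow> real"
  proof -
    have "(\<Sum>p\<in>UNIV. f p) = (\<Sum>x\<in>UNIV. \<Sum>w\<in>UNIV. f (x, w))"
      by (simp add: sum.cartesian_product)
    then show ?thesis by (simp add: UN sum.distrib)
  qed
  have delta: "(\<Sum>x'\<in>UNIV. (if x = x' then 1 else 0) * f x') = f x" for f :: "'a \<Rightarrow> real" and x
    by (subst sum.mono_neutral_right[of UNIV "{x}"]) auto
  have row: "(\<Sum>x'\<in>UNIV. (if G x x' then 1 else 0) * y $ x') = l * y $ x" for x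
    using arg_cong[OF assms(1), of "\<lambda>v. v $ x"]
    by (simp add: matrix_vector_mult_def real_adj_matrix_def)
  have "(real_adj_matrix (corona G K1) *v corona_lift \<theta> y) $ (x, w) = (\<theta> *\<^sub>R corona_lift \<theta> y) $ (x, w)" for x w
  proof (cases w)
    case None
    have "(real_adj_matrix (corona G K1) *v corona_lift \<theta> y) $ (x, w)
        = (\<Sum>x'\<in>UNIV. (if G x x' then 1 else 0) * (\<theta> * y $ x')) + y $ x"
      using None by (simp add: matrix_vector_mult_def real_adj_matrix_def S corona_lift_def corona_def
          delta)
    also have "(\<Sum>x'\<in>UNIV. (if G x x' then 1 else 0) * (\<theta> * y $ x'))
        = \<theta> * (\<Sum>x'\<in>UNIV. (if G x x' then 1 else 0) * y $ x')"
      by (simp add: sum_distrib_left mult_ac)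
    also have "\<dots> + y $ x = \<theta>\<^sup>2 * y $ x" unfolding row assms(2) by (simp add: algebra_simps)
    finally show ?thesis using None by (simp add: corona_lift_def power2_eq_square)
  next
    case (Some u)
    then show ?thesis
      by (simp add: matrix_vector_mult_def real_adj_matrix_def S corona_lift_def corona_def K1_def
          delta)
  qed
  then show ?thesis by (simp add: vec_eq_iff split_paired_all)
qed

text \<open>
  The vector \<open>(y, 0)\<close> on the corona, supported on the copy of \<open>G\<close>.
\<close>

definition corona_base :: "real^'a \<Rightarrow> real^('a \<times> unit option)" where
  "corona_base y = (\<chi> p. if snd p = None then y $ fst p else 0)"

lemma corona_base_nth: "corona_base y $ p = (if snd p = None then y $ fst p else 0)"
  by (simp add: corona_base_def)

lemma corona_base_sum: "corona_base (\<Sum>l\<in>S. c l *\<^sub>R y l) = (\<Sum>l\<in>S. c l *\<^sub>R corona_base (y l))"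
proof -
  have "corona_base (\<Sum>l\<in>S. c l *\<^sub>R y l) $ p = (\<Sum>l\<in>S. c l *\<^sub>R corona_base (y l)) $ p" for p
    by (cases "snd p = None") (simp_all add: corona_base_nth)
  then show ?thesis unfolding vec_eq_iff by blast
qed
lemma corona_base_axis: "corona_base (axis u 1) = axis (u, None) 1"
proof -
  have "corona_base (axis u 1) $ p = axis (u, None) 1 $ p" for p
    by (cases p) (simp add: corona_base_nth axis_def)
  then show ?thesis unfolding vec_eq_iff by blast
qed
lemma corona_lift_diff: "corona_lift \<theta> y - corona_lift \<theta>' y = (\<theta> - \<theta>') *\<^sub>R corona_base y"
  by (simp add: vec_eq_iff corona_base_nth corona_lift_def left_diff_distrib)

lemma norm_vector_scalar_mult: "norm (c *s z) = norm c * norm z" for z :: "complex^'n"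
  by (simp add: norm_vec_def norm_mult L2_set_right_distrib)

text \<open>
  The vector \<open>(y, 0)\<close> is \<open>1/\<Lambda>\<close> times the difference of the two lifts of \<open>y\<close>, where \<open>\<Lambda>\<close> is the
  difference of their eigenvalues. If both phases are close to \<open>\<gamma>\<close>, then \<open>(y, 0)\<close> is nearly
  multiplied by \<open>\<gamma>\<close>.
\<close>

lemma transition_corona_base_error:
  fixes G :: "'a::finite \<Rightarrow> 'a \<Rightarrow> bool"
  assumes eig: "real_adj_matrix G *v y = l *\<^sub>R y"
  defines "\<Lambda> \<equiv> sqrt (l\<^sup>2 + 4)"
  assumes p: "norm (cis (- (\<tau> * ((l + \<Lambda>) / 2))) - \<gamma>) \<le> \<delta>"
    and m: "norm (cis (- (\<tau> * ((l - \<Lambda>) / 2))) - \<gamma>) \<le> \<delta>"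
  shows "norm (transition_matrix (corona G K1) \<tau> *v complex_vec (corona_base y) - \<gamma> *s complex_vec (corona_base y))
    \<le> \<delta> * ((norm (complex_vec (corona_lift ((l + \<Lambda>) / 2) y)) + norm (complex_vec (corona_lift ((l - \<Lambda>) / 2) y))) / \<Lambda>)"
proof -
  have \<Lambda>: "\<Lambda> > 0" "\<Lambda>\<^sup>2 = l\<^sup>2 + 4" unfolding \<Lambda>_def by (auto intro: add_nonneg_pos)
  define \<theta> \<theta>' where "\<theta> = (l + \<Lambda>) / 2" and "\<theta>' = (l - \<Lambda>) / 2"
  define Y Y' where "Y = complex_vec (corona_lift \<theta> y)" and "Y' = complex_vec (corona_lift \<theta>' y)"
  let ?U = "transition_matrix (corona G K1) \<tau>"
  have q: "\<theta>\<^sup>2 = l * \<theta> + 1" "\<theta>'\<^sup>2 = l * \<theta>' + 1"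
    using \<Lambda>(2) by (simp_all add: \<theta>_def \<theta>'_def power2_eq_square field_simps)
  have ev: "?U *v complex_vec (corona_lift t y) = cis (- (\<tau> * t)) *s complex_vec (corona_lift t y)"
    if "t\<^sup>2 = l * t + 1" for t
    using corona_K1_eigenvector[OF eig that]
    by (intro transition_matrix_eigenvector)
      (simp only: adj_matrix_complex_vec complex_vec_scaleR)
  have base: "complex_vec (corona_base y) = of_real (1 / \<Lambda>) *s (Y - Y')"
  proof -
    have "corona_lift \<theta> y - corona_lift \<theta>' y = \<Lambda> *\<^sub>R corona_base y"
      unfolding corona_lift_diff by (simp add: \<theta>_def \<theta>'_def field_simps)
    then have "(corona_lift \<theta> y - corona_lift \<theta>' y) $ p = \<Lambda> * corona_base y $ p" for p by simp
    then have diff: "Y $ p - Y' $ p = of_real (\<Lambda> * corona_base y $ p)" for p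
      unfolding Y_def Y'_def by (simp flip: of_real_diff)
    have "complex_vec (corona_base y) $ p = (of_real (1 / \<Lambda>) *s (Y - Y')) $ p" for p
    proof -
      have "(of_real (1 / \<Lambda>) *s (Y - Y')) $ p = (Y $ p - Y' $ p) / of_real \<Lambda>"
        by (simp add: diff_divide_distrib)
      also have "\<dots> = of_real (\<Lambda> * corona_base y $ p) / of_real \<Lambda>" by (simp only: diff)
      finally show ?thesis using \<Lambda>(1) by simp
    qed
    then show ?thesis unfolding vec_eq_iff by blast
  qed
  have "?U *v complex_vec (corona_base y) - \<gamma> *s complex_vec (corona_base y)
      = of_real (1 / \<Lambda>) *s ((cis (- (\<tau> * \<theta>)) - \<gamma>) *s Y - (cis (- (\<tau> * \<theta>')) - \<gamma>) *s Y')"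
    unfolding base vector_scalar_commute vec.diff using ev[OF q(1)] ev[OF q(2)]
    by (simp add: Y_def Y'_def vec_eq_iff algebra_simps diff_divide_distrib)
  moreover have "norm (of_real (1 / \<Lambda>) *s w) = norm w / \<Lambda>" for w :: "complex^('a \<times> unit option)"
    unfolding norm_vector_scalar_mult using \<Lambda>(1) by (simp add: norm_divide)
  ultimately have "norm (?U *v complex_vec (corona_base y) - \<gamma> *s complex_vec (corona_base y))
      = norm ((cis (- (\<tau> * \<theta>)) - \<gamma>) *s Y - (cis (- (\<tau> * \<theta>')) - \<gamma>) *s Y') / \<Lambda>"
    by (simp only:)
  also have "\<dots> \<le> (norm ((cis (- (\<tau> * \<theta>)) - \<gamma>) *s Y) + norm ((cis (- (\<tau> * \<theta>')) - \<gamma>) *s Y')) / \<Lambda>"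
    using \<Lambda>(1) by (intro divide_right_mono norm_triangle_ineq4) auto
  also have "\<dots> \<le> (\<delta> * norm Y + \<delta> * norm Y') / \<Lambda>"
    using p m \<Lambda>(1) unfolding norm_vector_scalar_mult \<theta>_def[symmetric] \<theta>'_def[symmetric]
    by (intro divide_right_mono add_mono mult_right_mono) auto
  finally show ?thesis
    by (simp add: Y_def Y'_def \<theta>_def \<theta>'_def distrib_left)
qed

section \<open>Pretty good state transfer in the corona\<close>

theorem theorem5p6:
  fixes G :: "'a::finite \<Rightarrow> 'a \<Rightarrow> bool" and u v :: 'a
  assumes "simple_graph G"
    and "eigenvalue (adj_matrix G) 0"
    and "perfect_state_transfer G (pi / 2) u v"
  shows "pretty_good_state_transfer (corona G K1) (u, None) (v, None)"
proof -
  let ?M = "real_adj_matrix G"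
  let ?U = "transition_matrix (corona G K1)"
  obtain S y where S: "finite S" and eig: "\<And>l. ?M *v y l = l *\<^sub>R y l"
    and nz: "\<And>l. l \<in> S \<Longrightarrow> y l \<noteq> 0" and u: "axis u 1 = (\<Sum>l\<in>S. y l)"
    and orth: "\<And>l m. l \<noteq> m \<Longrightarrow> y l \<bullet> y m = 0"
    using symmetric_matrix_eigen_decomposition[OF transpose_real_adj_matrix[OF assms(1)]] by metis
  obtain \<gamma> \<sigma> where \<gamma>: "norm \<gamma> = 1" and \<sigma>: "\<And>l. l \<in> S \<Longrightarrow> \<sigma> l \<in> {1, -1}"
    and phase: "\<And>l. l \<in> S \<Longrightarrow> cis (- (pi / 2 * l)) = \<gamma> * of_real (\<sigma> l)"
    and v: "axis v 1 = (\<Sum>l\<in>S. \<sigma> l *\<^sub>R y l)"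
    using perfect_state_transfer_spectral[OF assms(3) S eig nz u orth] by blast
  \<comment> \<open>Squaring the phases removes the signs.\<close>
  have even: "(l - m) / 2 \<in> \<int>" if "l \<in> S" "m \<in> S" for l m
  proof -
    have sq: "cis (- (pi * n)) = \<gamma>\<^sup>2" if "n \<in> S" for n
    proof -
      have "cis (- (pi * n)) = (cis (- (pi / 2 * n)))\<^sup>2" by (simp add: power2_eq_square cis_mult)
      then show ?thesis using phase[OF that] \<sigma>[OF that] by (auto simp: power_mult_distrib)
    qed
    have "cis (pi * (l - m)) = cis (- (pi * m)) / cis (- (pi * l))"
      by (simp add: cis_divide algebra_simps)
    also have "\<dots> = 1" using sq[OF that(1)] sq[OF that(2)] cis_neq_zero[of "- (pi * m)"] by simp
    finally have "cos (pi * (l - m)) = 1" by (simp add: complex_eq_iff)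
    then obtain n :: int where "pi * (l - m) = of_int n * 2 * pi" unfolding cos_one_2pi_int by blast
    then have "pi * (l - m) = pi * (2 * of_int n)" by (simp add: mult_ac)
    then have "(l - m) / 2 = of_int n" by simp
    then show ?thesis by simp
  qed
  have int: "l \<in> \<int>" if "l \<in> S" for l
  proof (rule spectrum_integral[OF S, of "\<lambda>l x. y l $ x"])
    fix c :: "real \<Rightarrow> real" and m assume c: "\<And>x. (\<Sum>l\<in>S. c l * y l $ x) = 0" and m: "m \<in> S"
    have "(\<Sum>l\<in>S. c l *\<^sub>R y l) = 0" using c by (simp add: vec_eq_iff)
    then have "0 = (\<Sum>l\<in>S. c l *\<^sub>R y l) \<bullet> y m" by simp
    also have "\<dots> = (\<Sum>l\<in>S. if l = m then c m * (y m \<bullet> y m) else 0)"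
      unfolding inner_sum_left by (intro sum.cong) (auto simp: orth)
    also have "\<dots> = c m * (y m \<bullet> y m)" using S m by simp
    finally show "c m = 0" using nz[OF m] by simp
  next
    fix l m assume "l \<in> S" "m \<in> S"
    from even[OF this] have "(l - m) / 2 + (l - m) / 2 \<in> \<int>" by (intro Ints_add)
    then show "l - m \<in> \<int>" by (simp only: field_sum_of_halves)
  qed (use that vertex_moments_integral[OF eig u] in auto)
  have "\<exists>\<omega>\<in>{1, -1}. \<forall>\<delta>>0. \<exists>j :: int. \<forall>l\<in>S.
      norm (cis ((4 * of_int j + 1) * pi * (sqrt (l\<^sup>2 + 4) / 2)) - \<omega>) < \<delta>"
    using S int even by (rule corona_phases_simultaneous)
  then obtain \<omega> :: complex where \<omega>: "\<omega> \<in> {1, -1}"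
    and appr: "\<forall>\<delta>>0. \<exists>j :: int. \<forall>l\<in>S.
      norm (cis ((4 * of_int j + 1) * pi * (sqrt (l\<^sup>2 + 4) / 2)) - \<omega>) < \<delta>"
    by (rule bexE)
  \<comment> \<open>The constant in the error bound for the eigenvalue \<open>l\<close>.\<close>
  define K where "K l = (norm (complex_vec (corona_lift ((l + sqrt (l\<^sup>2 + 4)) / 2) (y l)))
    + norm (complex_vec (corona_lift ((l - sqrt (l\<^sup>2 + 4)) / 2) (y l)))) / sqrt (l\<^sup>2 + 4)" for l
  have K: "(\<Sum>l\<in>S. K l) \<ge> 0" by (intro sum_nonneg) (simp add: K_def)
  show ?thesis unfolding pretty_good_state_transfer_def
  proof (intro allI impI)
    fix \<epsilon> :: real assume "\<epsilon> > 0"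
    define \<delta> where "\<delta> = \<epsilon> / ((\<Sum>l\<in>S. K l) + 1)"
    have \<delta>: "\<delta> > 0" using \<open>\<epsilon> > 0\<close> K by (simp add: \<delta>_def)
    obtain j :: int where j: "\<And>l. l \<in> S \<Longrightarrow>
        norm (cis ((4 * of_int j + 1) * pi * (sqrt (l\<^sup>2 + 4) / 2)) - \<omega>) < \<delta>"
      using appr[rule_format, OF \<delta>] by (elim exE) (rule that, blast)
    define \<tau> where "\<tau> = (4 * of_int j + 1) * pi"
    have main: "norm (?U \<tau> *v complex_vec (corona_base (y l))
        - (\<gamma> * \<omega> * of_real (\<sigma> l)) *s complex_vec (corona_base (y l))) \<le> \<delta> * K l" if l: "l \<in> S" for l
    proof -
      define \<Lambda> where "\<Lambda> = sqrt (l\<^sup>2 + 4)"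
      have half: "cis (- (\<tau> * (l / 2))) = \<gamma> * of_real (\<sigma> l)"
      proof -
        obtain n where n: "l = of_int n" using int[OF l] by (auto elim: Ints_cases)
        have eq: "- (\<tau> * (l / 2)) = - (pi / 2 * l) + 2 * pi * of_int (- (j * n))"
          unfolding \<tau>_def n by (simp add: algebra_simps)
        have one: "cis (2 * pi * of_int (- (j * n))) = 1" by (rule cis_multiple_2pi) simp
        show ?thesis by (simp only: eq cis_mult[symmetric] one phase[OF l] mult_1_right)
      qed
      have plus: "norm (cis (\<tau> * (\<Lambda> / 2)) - \<omega>) \<le> \<delta>"
        using j[OF l] by (simp add: \<tau>_def \<Lambda>_def)
      have minus: "norm (cis (- (\<tau> * (\<Lambda> / 2))) - \<omega>) \<le> \<delta>"
      proof -
        \<comment> \<open>The sign \<open>\<omega>\<close> is real.\<close>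
        have "cis (- (\<tau> * (\<Lambda> / 2))) - \<omega> = cnj (cis (\<tau> * (\<Lambda> / 2)) - \<omega>)"
          using \<omega> by (auto simp: cis_cnj)
        then show ?thesis using plus by (simp only: complex_mod_cnj)
      qed
      have split: "norm (cis (- (\<tau> * (l / 2)) + x) - \<gamma> * \<omega> * of_real (\<sigma> l)) = norm (cis x - \<omega>)" for x
      proof -
        have "cis (- (\<tau> * (l / 2)) + x) - \<gamma> * \<omega> * of_real (\<sigma> l) = \<gamma> * of_real (\<sigma> l) * (cis x - \<omega>)"
          unfolding cis_mult[symmetric] half by (simp add: algebra_simps)
        then show ?thesis using \<gamma> \<sigma>[OF l] by (auto simp: norm_mult)
      qed
      show ?thesis unfolding K_def
      proof (rule transition_corona_base_error[OF eig])
        have "- (\<tau> * ((l + \<Lambda>) / 2)) = - (\<tau> * (l / 2)) + - (\<tau> * (\<Lambda> / 2))"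
          by (simp add: field_simps)
        then show "norm (cis (- (\<tau> * ((l + sqrt (l\<^sup>2 + 4)) / 2))) - \<gamma> * \<omega> * of_real (\<sigma> l)) \<le> \<delta>"
          using minus split by (simp only: \<Lambda>_def)
        have "- (\<tau> * ((l - \<Lambda>) / 2)) = - (\<tau> * (l / 2)) + \<tau> * (\<Lambda> / 2)"
          by (simp add: field_simps)
        then show "norm (cis (- (\<tau> * ((l - sqrt (l\<^sup>2 + 4)) / 2))) - \<gamma> * \<omega> * of_real (\<sigma> l)) \<le> \<delta>"
          using plus split by (simp only: \<Lambda>_def)
      qed
    qed
    have base: "axis (w, None) 1 = complex_vec (corona_base (axis w 1))" for w :: 'a
      by (simp only: corona_base_axis complex_vec_axis)
    have base_u: "axis (u, None) 1 = (\<Sum>l\<in>S. complex_vec (corona_base (y l)))"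
      using corona_base_sum[of "\<lambda>_. 1" y S] by (simp only: base u scaleR_one complex_vec_sum)
    have base_v: "axis (v, None) 1 = (\<Sum>l\<in>S. of_real (\<sigma> l) *s complex_vec (corona_base (y l)))"
      by (simp only: base v corona_base_sum complex_vec_sum complex_vec_scaleR)
    have "?U \<tau> *v axis (u, None) 1 - (\<gamma> * \<omega>) *s axis (v, None) 1
        = (\<Sum>l\<in>S. ?U \<tau> *v complex_vec (corona_base (y l))
            - (\<gamma> * \<omega> * of_real (\<sigma> l)) *s complex_vec (corona_base (y l)))"
      unfolding base_u base_v
      by (simp only: vec.sum vec.scale_sum_right vec.scale_scale sum_subtractf)
    also have "norm \<dots> \<le> (\<Sum>l\<in>S. \<delta> * K l)" using main by (rule sum_norm_le)
    also have "\<dots> = \<delta> * (\<Sum>l\<in>S. K l)" by (simp add: sum_distrib_left)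
    also have "\<dots> < \<delta> * ((\<Sum>l\<in>S. K l) + 1)" using \<delta> by simp
    also have "\<dots> = \<epsilon>" using K by (simp add: \<delta>_def)
    finally have "norm (?U \<tau> *v axis (u, None) 1 - (\<gamma> * \<omega>) *s axis (v, None) 1) < \<epsilon>" .
    moreover have "norm (\<gamma> * \<omega>) = 1" using \<gamma> \<omega> by (auto simp: norm_mult)
    ultimately show "\<exists>\<tau> \<gamma>. norm \<gamma> = 1 \<and> norm (?U \<tau> *v axis (u, None) 1 - \<gamma> *s axis (v, None) 1) < \<epsilon>"
      by blast
  qed
qed

end
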